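(* Let $\mathcal{X},\mathcal{A}$ be finite sets, let $P_{A|X}$ be a channel from $\mathcal{X}$ to $\mathcal{A}$, and for each $n\ge 1$ let $P^{\times n}_{XAB}$ be the distribution on $\mathcal{X}^n\times\mathcal{A}^n\times\mathcal{A}^n$ given by $P^{\times n}_{XAB}(x^n,a^n,b^n)=|\mathcal{X}|^{-n}\prod_{i=1}^n P_{A|X}(a_i|x_i)P_{A|X}(b_i|x_i)$. Then $$\lim_{n\to\infty}\frac{\log \omega_{\mathrm{c}}(n)}{n}=\lim_{n\to\infty}\frac{\log \omega_{\mathrm{q}}(n)}{n}=\lim_{n\to\infty}\frac{\log \omega_{\mathrm{ns}}(n)}{n}=\max_{Q_{XA}}\Big( I(X;A)_Q-2D(Q_{A|X}\,\|\,P_{A|X}\mid Q_X)\Big)-\log|\mathcal{X}|,$$ where the maximum is over all probability distributions $Q_{XA}$ on $\mathcal{X}\times\mathcal{A}$ (in particular, all three limits exist).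
   Context: All logarithms are base $2$. Write $P=P^{\times n}_{XAB}$. The classical value is $\omega_{\mathrm{c}}(n)=\max_{f,g}\sum_{x^n,a^n,b^n}P(x^n,a^n,b^n)\,\delta[f(a^n)=g(b^n)=x^n]$, maximized over all functions $f,g\colon\mathcal{A}^n\to\mathcal{X}^n$ ($\delta$ the indicator). The quantum value is $\omega_{\mathrm{q}}(n)=\sup_{d\ge1}\sup_{\sigma,M,N}\sum_{x^n,a^n,b^n}P(x^n,a^n,b^n)\operatorname{tr}[\sigma(M_{x^n}(a^n)\otimes N_{x^n}(b^n))]$, where $\sigma$ ranges over density matrices on $\mathbb{C}^d\otimes\mathbb{C}^d$ and, for each $a^n$ (resp. $b^n$), $\{M_{x^n}(a^n)\}_{x^n\in\mathcal{X}^n}$ (resp. $\{N_{x^n}(b^n)\}$) is a POVM on $\mathbb{C}^d$. The no-signalling value is $\omega_{\mathrm{ns}}(n)=\sup_{Q}\sum P(x^n,a^n,b^n)Q(x^n,x^n|a^n,b^n)$ over all conditional distributions $Q(y,z|a^n,b^n)$ on $\mathcal{X}^n\times\mathcal{X}^n$ given $(a^n,b^n)\in\mathcal{A}^n\times\mathcal{A}^n$ that are no-signalling: $\sum_{y}Q(y,z|a^n,b^n)$ does not depend on $a^n$ and $\sum_{z}Q(y,z|a^n,b^n)$ does not depend on $b^n$. For a distribution $Q_{XA}$: $I(X;A)_Q=H(X)_Q+H(A)_Q-H(X,A)_Q$ with Shannon entropies $H$; $D(P\|Q)=\sum_x P(x)\log\frac{P(x)}{Q(x)}$; and $D(Q_{A|X}\|P_{A|X}\mid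 Q_X)=\sum_x Q_X(x)D(Q_{A|X=x}\|P_{A|X=x})$. *)

theory Defs
  imports Complex_Main "Jordan_Normal_Form.Matrix"
begin

definition seqs :: "nat \<Rightarrow> 'a list set" where
  "seqs n = {xs. length xs = n}"

definition channel :: "('x::finite \<Rightarrow> 'a::finite \<Rightarrow> real) \<Rightarrow> bool" where
  "channel W \<longleftrightarrow> (\<forall>x a. 0 \<le> W x a) \<and> (\<forall>x. (\<Sum>a\<in>UNIV. W x a) = 1)"

definition Pn :: "('x::finite \<Rightarrow> 'a::finite \<Rightarrow> real) \<Rightarrow> nat \<Rightarrow> 'x list \<Rightarrow> 'a list \<Rightarrow> 'a list \<Rightarrow> real" where
  "Pn W n xs us vs = (1 / real (card (UNIV :: 'x set))) ^ n *
      (\<Prod>i<n. W (xs ! i) (us ! i) * W (xs ! i) (vs ! i))"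

definition game_sum :: "('x::finite \<Rightarrow> 'a::finite \<Rightarrow> real) \<Rightarrow> nat \<Rightarrow>
    ('x list \<Rightarrow> 'a list \<Rightarrow> 'a list \<Rightarrow> real) \<Rightarrow> real" where
  "game_sum W n F = (\<Sum>xs\<in>seqs n. \<Sum>us\<in>seqs n. \<Sum>vs\<in>seqs n. Pn W n xs us vs * F xs us vs)"

definition omega_c :: "('x::finite \<Rightarrow> 'a::finite \<Rightarrow> real) \<Rightarrow> nat \<Rightarrow> real" where
  "omega_c W n = Max ((\<lambda>(f, g). game_sum W n
        (\<lambda>xs us vs. if f us = xs \<and> g vs = xs then 1 else 0))
      ` ((seqs n \<rightarrow>\<^sub>E (seqs n :: 'x list set)) \<times> (seqs n \<rightarrow>\<^sub>E (seqs n :: 'x list set))))"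

definition mtrace :: "complex mat \<Rightarrow> complex" where
  "mtrace A = (\<Sum>i<dim_row A. A $$ (i, i))"

definition kron :: "complex mat \<Rightarrow> complex mat \<Rightarrow> complex mat" where
  "kron A B = mat (dim_row A * dim_row B) (dim_col A * dim_col B)
     (\<lambda>(i, j). A $$ (i div dim_row B, j div dim_col B) * B $$ (i mod dim_row B, j mod dim_col B))"

definition psd :: "nat \<Rightarrow> complex mat \<Rightarrow> bool" where
  "psd d A \<longleftrightarrow> A \<in> carrier_mat d d \<and>
     (\<forall>v \<in> carrier_vec d.
        let q = (\<Sum>i<d. \<Sum>j<d. cnj (v $ i) * A $$ (i, j) * v $ j) in Im q = 0 \<and> 0 \<le> Re q)"

definition density :: "nat \<Rightarrow> complex mat \<Rightarrow> bool" where
  "density d \<sigma> \<longleftrightarrow> psd d \<sigma> \<and> mtrace \<sigma> = 1"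

definition povm :: "nat \<Rightarrow> 'y set \<Rightarrow> ('y \<Rightarrow> complex mat) \<Rightarrow> bool" where
  "povm d S Ms \<longleftrightarrow> (\<forall>y\<in>S. psd d (Ms y)) \<and>
     (\<forall>i<d. \<forall>j<d. (\<Sum>y\<in>S. Ms y $$ (i, j)) = (if i = j then 1 else 0))"

definition quantum_strategies :: "nat \<Rightarrow> nat \<Rightarrow>
    (complex mat \<times> ('a list \<Rightarrow> 'x list \<Rightarrow> complex mat) \<times> ('a list \<Rightarrow> 'x list \<Rightarrow> complex mat)) set" where
  "quantum_strategies n d = {(\<sigma>, M, N). density (d * d) \<sigma> \<and>
      (\<forall>us\<in>seqs n. povm d (seqs n) (M us)) \<and> (\<forall>vs\<in>seqs n. povm d (seqs n) (N vs))}"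

definition omega_q :: "('x::finite \<Rightarrow> 'a::finite \<Rightarrow> real) \<Rightarrow> nat \<Rightarrow> real" where
  "omega_q W n = Sup {game_sum W n (\<lambda>xs us vs. Re (mtrace (\<sigma> * kron (M us xs) (N vs xs))))
      | d \<sigma> M N. d \<ge> 1 \<and> (\<sigma>, M, N) \<in> quantum_strategies n d}"

definition ns_boxes :: "nat \<Rightarrow> ('x::finite list \<Rightarrow> 'x list \<Rightarrow> 'a::finite list \<Rightarrow> 'a list \<Rightarrow> real) set" where
  "ns_boxes n = {Q. (\<forall>y\<in>seqs n. \<forall>z\<in>seqs n. \<forall>a\<in>seqs n. \<forall>b\<in>seqs n. 0 \<le> Q y z a b) \<and>
      (\<forall>a\<in>seqs n. \<forall>b\<in>seqs n. (\<Sum>y\<in>seqs n. \<Sum>z\<in>seqs n. Q y z a b) = 1) \<and>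
      (\<forall>z\<in>seqs n. \<forall>a\<in>seqs n. \<forall>a'\<in>seqs n. \<forall>b\<in>seqs n.
          (\<Sum>y\<in>seqs n. Q y z a b) = (\<Sum>y\<in>seqs n. Q y z a' b)) \<and>
      (\<forall>y\<in>seqs n. \<forall>a\<in>seqs n. \<forall>b\<in>seqs n. \<forall>b'\<in>seqs n.
          (\<Sum>z\<in>seqs n. Q y z a b) = (\<Sum>z\<in>seqs n. Q y z a b'))}"

definition omega_ns :: "('x::finite \<Rightarrow> 'a::finite \<Rightarrow> real) \<Rightarrow> nat \<Rightarrow> real" where
  "omega_ns W n = Sup {game_sum W n (\<lambda>xs us vs. Q xs xs us vs) | Q. Q \<in> ns_boxes n}"

definition entropy :: "('b::finite \<Rightarrow> real) \<Rightarrow> real" where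
  "entropy p = - (\<Sum>u\<in>UNIV. if p u = 0 then 0 else p u * log 2 (p u))"

definition marg_X :: "('x::finite \<times> 'a::finite \<Rightarrow> real) \<Rightarrow> 'x \<Rightarrow> real" where
  "marg_X Q x = (\<Sum>a\<in>UNIV. Q (x, a))"

definition marg_A :: "('x::finite \<times> 'a::finite \<Rightarrow> real) \<Rightarrow> 'a \<Rightarrow> real" where
  "marg_A Q a = (\<Sum>x\<in>UNIV. Q (x, a))"

definition mutual_info :: "('x::finite \<times> 'a::finite \<Rightarrow> real) \<Rightarrow> real" where
  "mutual_info Q = entropy (marg_X Q) + entropy (marg_A Q) - entropy Q"

(* D(p||q); only used when p is absolutely continuous w.r.t. q *)
definition rel_entropy :: "('b::finite \<Rightarrow> real) \<Rightarrow> ('b \<Rightarrow> real) \<Rightarrow> real" where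
  "rel_entropy p q = (\<Sum>u\<in>UNIV. if p u = 0 then 0 else p u * log 2 (p u / q u))"

definition cond_rel_entropy :: "('x::finite \<times> 'a::finite \<Rightarrow> real) \<Rightarrow> ('x \<Rightarrow> 'a \<Rightarrow> real) \<Rightarrow> real" where
  "cond_rel_entropy Q W = (\<Sum>x\<in>UNIV. marg_X Q x *
       rel_entropy (\<lambda>a. Q (x, a) / marg_X Q x) (\<lambda>a. W x a))"

definition distr :: "('b::finite \<Rightarrow> real) \<Rightarrow> bool" where
  "distr Q \<longleftrightarrow> (\<forall>u. 0 \<le> Q u) \<and> (\<Sum>u\<in>UNIV. Q u) = 1"

(* Q_{A|X} \<ll> P_{A|X} on the support of Q_X; otherwise the conditional divergence is +\<infinity>
   and the objective is -\<infinity>, so such Q never attain the maximum. *)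
definition abs_cont :: "('x::finite \<times> 'a::finite \<Rightarrow> real) \<Rightarrow> ('x \<Rightarrow> 'a \<Rightarrow> real) \<Rightarrow> bool" where
  "abs_cont Q W \<longleftrightarrow> (\<forall>x a. W x a = 0 \<longrightarrow> Q (x, a) = 0)"

definition objective :: "('x::finite \<times> 'a::finite \<Rightarrow> real) \<Rightarrow> ('x \<Rightarrow> 'a \<Rightarrow> real) \<Rightarrow> real" where
  "objective Q W = mutual_info Q - 2 * cond_rel_entropy Q W"

end

(* The common exponent is a Renyi capacity of order 2. At a maximizer Q with output marginal t = Q_A,
   the first-order optimality condition gives the certificate
   sum_a W(a|x)^2 / t(a) <= 2^objective for every input x. The certificate is multiplicative, and
   with AM-GM it bounds the no-signalling value by (2^objective / |X|)^n without error term.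
   Conversely, a code for the channel Q_{A|X} of rate I(X;A) with both players decoding alike wins
   with probability about |X|^{-n} times the number of codewords times 2^{-2nD}: the actual channel W
   produces the typical set of a codeword with probability about 2^{-nD}. *)

theory Submission
  imports Defs "HOL-Analysis.Function_Topology" "HOL-Real_Asymp.Real_Asymp"
begin

text \<open>Only the two ends of the chain classical \<le> quantum \<le> no-signalling are
  estimated. Quantum strategies enter solely through their boxes, and the one point there that needs
  work is that the trace of a density matrix against a tensor product of positive semidefinite
  matrices is nonnegative. First-order optimality is strong enough because the objective is concave
  in Q: mutual information brings in -H(A|X), of the wrong curvature, but the doubled divergence
  contributes +2 H(A|X), which leaves H(A) + H(A|X) and a linear term. The factor 2 reflects the two
  independent observations and becomes the square of W in the certificate. The obstacle is the
  boundary of the simplex: where t(a) = 0 the entropy is not differentiable and W^2/t is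
  meaningless, so it has to be shown that no input of the channel reaches such a letter. Apart from
  an arbitrarily small loss of rate, the code costs only constants: 1/2 for the decoding of each
  player and 1/4 in the number of codewords. Their product 1/16 vanishes in the exponent.\<close>

section \<open>Sums over sequences\<close>

lemma finite_seqs [simp]: "finite (seqs n :: 'b::finite list set)"
  using finite_lists_length_eq[of "UNIV :: 'b set" n] by (simp add: seqs_def)

lemma seqs_0 [simp]: "seqs 0 = {[]}"
  by (auto simp: seqs_def)

lemma seqs_nonempty [simp]: "seqs n \<noteq> {}"
  by (auto simp: seqs_def intro: Ex_list_of_length)

lemma sum_seqs_Suc:
  fixes F :: "'b::finite list \<Rightarrow> 'c::comm_monoid_add"
  shows "(\<Sum>xs\<in>seqs (Suc n). F xs) = (\<Sum>x\<in>UNIV. \<Sum>xs\<in>seqs n. F (x # xs))"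
proof -
  have "bij_betw (\<lambda>(x, xs). x # xs) (UNIV \<times> seqs n) (seqs (Suc n) :: 'b list set)"
    by (rule bij_betwI[where g = "\<lambda>xs. (hd xs, tl xs)"]) (auto simp: seqs_def length_Suc_conv)
  then show ?thesis
    by (simp add: sum.cartesian_product sum.reindex_bij_betw[symmetric] case_prod_unfold)
qed

lemma sum_seqs_prod:
  fixes h :: "nat \<Rightarrow> 'b::finite \<Rightarrow> 'c::comm_semiring_1"
  shows "(\<Sum>xs\<in>seqs n. \<Prod>i<n. h i (xs ! i)) = (\<Prod>i<n. \<Sum>x\<in>UNIV. h i x)"
proof (induction n arbitrary: h)
  case (Suc n)
  show ?case
    using Suc[of "\<lambda>i. h (Suc i)"]
    by (simp add: sum_seqs_Suc prod.lessThan_Suc_shift sum_distrib_left[symmetric] sum_distrib_right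
        del: prod.lessThan_Suc)
qed simp

text \<open>The kernel \<open>g\<close> is left arbitrary since channels, joint laws and the ratio
  \<open>(W x a)\<^sup>2 / t a\<close> of the upper bound are all extended letterwise.\<close>

definition seqprod :: "('x \<Rightarrow> 'a \<Rightarrow> real) \<Rightarrow> nat \<Rightarrow> 'x list \<Rightarrow> 'a list \<Rightarrow> real" where
  "seqprod g n xs us = (\<Prod>i<n. g (xs ! i) (us ! i))"

lemma seqprod_0 [simp]: "seqprod g 0 xs us = 1"
  by (simp add: seqprod_def)

lemma seqprod_Suc [simp]: "seqprod g (Suc n) (x # xs) (u # us) = g x u * seqprod g n xs us"
  by (simp add: seqprod_def prod.lessThan_Suc_shift del: prod.lessThan_Suc)

lemma seqprod_nonneg: "(\<And>x u. 0 \<le> g x u) \<Longrightarrow> 0 \<le> seqprod g n xs us"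
  by (simp add: seqprod_def prod_nonneg)

lemma seqprod_exp_sum:
  assumes "\<And>i. i < n \<Longrightarrow> 0 < g (xs ! i) (us ! i)"
  shows "seqprod g n xs us = exp (\<Sum>i<n. ln (g (xs ! i) (us ! i)))"
  using assms by (simp add: seqprod_def exp_sum)

lemma sum_seqprod:
  fixes g :: "'x \<Rightarrow> 'a::finite \<Rightarrow> real"
  shows "(\<Sum>us\<in>seqs n. seqprod g n xs us) = (\<Prod>i<n. \<Sum>u\<in>UNIV. g (xs ! i) u)"
  unfolding seqprod_def by (rule sum_seqs_prod)

lemma Pn_eq_seqprod:
  fixes W :: "'x::finite \<Rightarrow> 'a::finite \<Rightarrow> real"
  shows "Pn W n xs us vs = (1 / real (card (UNIV :: 'x set))) ^ n * (seqprod W n xs us * seqprod W n xs vs)"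
  by (simp add: Pn_def seqprod_def prod.distrib)

lemma sum_seqs_pair_Suc:
  fixes F :: "'x::finite list \<Rightarrow> 'a::finite list \<Rightarrow> 'c::comm_monoid_add"
  shows "(\<Sum>xs\<in>seqs (Suc n). \<Sum>us\<in>seqs (Suc n). F xs us) =
    (\<Sum>x\<in>UNIV. \<Sum>u\<in>UNIV. \<Sum>xs\<in>seqs n. \<Sum>us\<in>seqs n. F (x # xs) (u # us))"
  unfolding sum_seqs_Suc by (intro sum.cong refl sum.swap)

lemma sum_square_pair:
  fixes c :: "real" and P S :: "'b \<Rightarrow> 'c \<Rightarrow> real"
  shows "(\<Sum>x\<in>A. \<Sum>u\<in>B. c * P x u * (h + S x u)\<^sup>2) =
    c * (h\<^sup>2 * (\<Sum>x\<in>A. \<Sum>u\<in>B. P x u) + 2 * h * (\<Sum>x\<in>A. \<Sum>u\<in>B. P x u * S x u)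
      + (\<Sum>x\<in>A. \<Sum>u\<in>B. P x u * (S x u)\<^sup>2))"
  by (simp add: power2_sum distrib_left sum.distrib sum_distrib_left sum_distrib_right ac_simps)

text \<open>Variances of independent centred letters add: in the induction step the cross term of
  \<open>sum_square_pair\<close> is a multiple of the mean over the shorter sequences, which is
  zero. Chebyshev's inequality in \<open>typical_mass\<close> rests on this.\<close>

lemma seqprod_moments:
  fixes p h :: "'x::finite \<Rightarrow> 'a::finite \<Rightarrow> real"
  assumes p1: "(\<Sum>x\<in>UNIV. \<Sum>u\<in>UNIV. p x u) = 1"
    and h0: "(\<Sum>x\<in>UNIV. \<Sum>u\<in>UNIV. p x u * h x u) = 0"
  defines "S \<equiv> \<lambda>n xs us. \<Sum>i<n. h (xs ! i) (us ! i)"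
  shows sum_seqprod_pair: "(\<Sum>xs\<in>seqs n. \<Sum>us\<in>seqs n. seqprod p n xs us) = 1"
    and seqprod_mean: "(\<Sum>xs\<in>seqs n. \<Sum>us\<in>seqs n. seqprod p n xs us * S n xs us) = 0"
    and seqprod_variance: "(\<Sum>xs\<in>seqs n. \<Sum>us\<in>seqs n. seqprod p n xs us * (S n xs us)\<^sup>2) =
      real n * (\<Sum>x\<in>UNIV. \<Sum>u\<in>UNIV. p x u * (h x u)\<^sup>2)"
proof -
  have S0: "S 0 xs us = 0" for xs us by (simp add: S_def)
  have SS: "S (Suc n) (x # xs) (u # us) = h x u + S n xs us" for n x xs u us
    by (simp add: S_def sum.lessThan_Suc_shift del: sum.lessThan_Suc)
  show 1: "(\<Sum>xs\<in>seqs n. \<Sum>us\<in>seqs n. seqprod p n xs us) = 1" for n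
    by (induction n) (simp_all add: sum_seqs_pair_Suc sum_distrib_left[symmetric] p1)
  show 2: "(\<Sum>xs\<in>seqs n. \<Sum>us\<in>seqs n. seqprod p n xs us * S n xs us) = 0" for n
  proof (induction n)
    case (Suc n)
    then show ?case
      by (simp add: sum_seqs_pair_Suc SS distrib_left sum.distrib mult.assoc sum_distrib_left[symmetric])
        (simp add: sum_distrib_right[symmetric] 1 h0)
  qed (simp add: S0)
  show "(\<Sum>xs\<in>seqs n. \<Sum>us\<in>seqs n. seqprod p n xs us * (S n xs us)\<^sup>2) =
      real n * (\<Sum>x\<in>UNIV. \<Sum>u\<in>UNIV. p x u * (h x u)\<^sup>2)"
  proof (induction n)
    case (Suc n)
    have "(\<Sum>xs\<in>seqs (Suc n). \<Sum>us\<in>seqs (Suc n). seqprod p (Suc n) xs us * (S (Suc n) xs us)\<^sup>2)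
      = (\<Sum>x\<in>UNIV. \<Sum>u\<in>UNIV. p x u * (h x u)\<^sup>2 + p x u *
          (real n * (\<Sum>x\<in>UNIV. \<Sum>u\<in>UNIV. p x u * (h x u)\<^sup>2)))"
      by (simp add: sum_seqs_pair_Suc SS sum_square_pair 1 2 Suc distrib_left)
    also have "\<dots> = real (Suc n) * (\<Sum>x\<in>UNIV. \<Sum>u\<in>UNIV. p x u * (h x u)\<^sup>2)"
      by (simp only: sum.distrib sum_distrib_right[symmetric] p1) (simp add: algebra_simps)
    finally show ?case .
  qed (simp add: S0)
qed

section \<open>The objective and its maximizer\<close>

lemma sum_UNIV_prod:
  fixes F :: "'x::finite \<times> 'a::finite \<Rightarrow> 'c::comm_monoid_add"
  shows "(\<Sum>u\<in>UNIV. F u) = (\<Sum>x\<in>UNIV. \<Sum>a\<in>UNIV. F (x, a))"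
  by (simp add: sum.cartesian_product)

lemma distr_le_marg:
  assumes "distr Q"
  shows "0 \<le> Q (x, a)" "Q (x, a) \<le> marg_X Q x" "Q (x, a) \<le> marg_A Q a"
  using assms by (auto simp: distr_def marg_X_def marg_A_def
      intro: member_le_sum[of a UNIV "\<lambda>a. Q (x, a)"] member_le_sum[of x UNIV "\<lambda>x. Q (x, a)"])

lemma marg_nonneg:
  assumes "distr Q"
  shows "0 \<le> marg_X Q x" "0 \<le> marg_A Q a"
  using assms by (auto simp: distr_def marg_X_def marg_A_def intro: sum_nonneg)

lemma sum_marg:
  assumes "distr Q"
  shows "(\<Sum>x\<in>UNIV. marg_X Q x) = 1" "(\<Sum>a\<in>UNIV. marg_A Q a) = 1"
  using assms sum.swap[of "\<lambda>x a. Q (x, a)" UNIV UNIV]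
  by (auto simp: distr_def marg_X_def marg_A_def sum_UNIV_prod)

text \<open>The factor in front of the logarithm absorbs the case distinction at zero. From here on
  the estimates are in nats.\<close>

lemma entropy_ln: "entropy p * ln 2 = - (\<Sum>u\<in>UNIV. p u * ln (p u))"
  by (simp add: entropy_def sum_distrib_right log_def cong: if_cong)
    (rule sum.cong; simp)

lemma cond_rel_entropy_ln:
  assumes Q: "distr Q" "abs_cont Q W" and W: "\<And>x a. 0 \<le> W x a"
  shows "cond_rel_entropy Q W * ln 2 =
    (\<Sum>x\<in>UNIV. \<Sum>a\<in>UNIV. Q (x, a) * ln (Q (x, a) / marg_X Q x) - Q (x, a) * ln (W x a))"
proof -
  have "marg_X Q x * (if Q (x, a) / marg_X Q x = 0 then 0
      else Q (x, a) / marg_X Q x * log 2 (Q (x, a) / marg_X Q x / W x a)) * ln 2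
    = Q (x, a) * ln (Q (x, a) / marg_X Q x) - Q (x, a) * ln (W x a)" for x a
  proof (cases "Q (x, a) = 0")
    case False
    then have "0 < Q (x, a)" "0 < marg_X Q x" "0 < W x a"
      using distr_le_marg[OF Q(1), of x a] Q(2) W[of x a] by (auto simp: abs_cont_def less_le)
    then show ?thesis by (simp add: log_def ln_div ln_mult right_diff_distrib distrib_left)
  qed simp
  then show ?thesis
    by (simp only: cond_rel_entropy_def rel_entropy_def sum_distrib_left sum_distrib_right)
qed

text \<open>Two groupings for two uses. The conditional one displays H(A) + H(A|X), whose concavity
  the perturbation exploits; the joint one has, besides a linear part, only terms
  \<open>y * ln y\<close>, which are continuous up to the boundary.\<close>

lemma objective_ln:
  assumes Q: "distr Q" "abs_cont Q W" and W: "\<And>x a. 0 \<le> W x a"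
  shows "objective Q W * ln 2 = - (\<Sum>a\<in>UNIV. marg_A Q a * ln (marg_A Q a))
      - (\<Sum>x\<in>UNIV. \<Sum>a\<in>UNIV. Q (x, a) * ln (Q (x, a) / marg_X Q x))
      + 2 * (\<Sum>x\<in>UNIV. \<Sum>a\<in>UNIV. Q (x, a) * ln (W x a))" (is ?conditional)
    and "objective Q W * ln 2 = - (\<Sum>a\<in>UNIV. marg_A Q a * ln (marg_A Q a))
      + (\<Sum>x\<in>UNIV. marg_X Q x * ln (marg_X Q x)) - (\<Sum>u\<in>UNIV. Q u * ln (Q u))
      + 2 * (\<Sum>x\<in>UNIV. \<Sum>a\<in>UNIV. Q (x, a) * ln (W x a))" (is ?joint)
proof -
  have "Q (x, a) * ln (Q (x, a) / marg_X Q x) = Q (x, a) * ln (Q (x, a)) - Q (x, a) * ln (marg_X Q x)" for x a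
    using distr_le_marg[OF Q(1), of x a] by (cases "Q (x, a) = 0") (auto simp: ln_div right_diff_distrib)
  then have eq: "(\<Sum>x\<in>UNIV. \<Sum>a\<in>UNIV. Q (x, a) * ln (Q (x, a) / marg_X Q x))
    = (\<Sum>u\<in>UNIV. Q u * ln (Q u)) - (\<Sum>x\<in>UNIV. marg_X Q x * ln (marg_X Q x))"
    by (simp add: sum_UNIV_prod sum_subtractf marg_X_def sum_distrib_right)
  have "objective Q W * ln 2 = entropy (marg_X Q) * ln 2 + entropy (marg_A Q) * ln 2 - entropy Q * ln 2
      - 2 * (cond_rel_entropy Q W * ln 2)"
    by (simp add: objective_def mutual_info_def algebra_simps)
  then show ?conditional ?joint
    unfolding entropy_ln cond_rel_entropy_ln[OF assms] sum_subtractf eq by simp_all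
qed

section \<open>Existence of a maximizer\<close>

lemma continuous_on_mult_ln: "continuous_on {0..} (\<lambda>x::real. x * ln x)"
proof (rule continuous_on_eq_continuous_within[THEN iffD2], rule ballI)
  fix x :: real assume "x \<in> {0..}"
  show "continuous (at x within {0..}) (\<lambda>x. x * ln x)"
  proof (cases "x = 0")
    case True
    have "((\<lambda>x::real. x * ln x) \<longlongrightarrow> 0) (at_right 0)" by real_asymp
    then show ?thesis
      using at_within_Ici_at_right[of "0::real"] True by (simp add: continuous_within)
  next
    case False
    then show ?thesis using \<open>x \<in> {0..}\<close> by (auto intro!: continuous_intros)
  qed
qed

lemma continuous_on_mult_ln' [continuous_intros]:
  assumes "continuous_on S f" "\<And>x. x \<in> S \<Longrightarrow> 0 \<le> f x"
  shows "continuous_on S (\<lambda>x. f x * ln (f x :: real))"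
  by (rule continuous_on_compose2[OF continuous_on_mult_ln assms(1)]) (use assms(2) in auto)

lemma compact_distr: "compact {Q :: 'b::finite \<Rightarrow> real. distr Q}"
proof -
  have "compactin (product_topology (\<lambda>_::'b. euclidean :: real topology) UNIV) (Pi\<^sub>E UNIV (\<lambda>_. {0..1}))"
    by (subst compactin_PiE) (simp add: compact_Icc)
  then have "compact (Pi\<^sub>E (UNIV :: 'b set) (\<lambda>_. {0..1 :: real}))"
    by (simp add: euclidean_product_topology)
  moreover have "closed {Q :: 'b \<Rightarrow> real. distr Q}"
    unfolding distr_def
    by (intro closed_Collect_conj closed_Collect_all closed_Collect_le closed_Collect_eq
        continuous_intros continuous_on_product_coordinates)
  ultimately have "compact (Pi\<^sub>E UNIV (\<lambda>_. {0..1}) \<inter> {Q :: 'b \<Rightarrow> real. distr Q})"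
    by (rule compact_Int_closed)
  moreover have "Q u \<le> 1" if "distr Q" for Q :: "'b \<Rightarrow> real" and u
    using that member_le_sum[of u UNIV Q] by (auto simp: distr_def)
  then have "Pi\<^sub>E UNIV (\<lambda>_. {0..1}) \<inter> {Q :: 'b \<Rightarrow> real. distr Q} = {Q. distr Q}"
    by (auto simp: distr_def)
  ultimately show ?thesis by simp
qed

lemma objective_attains_max:
  fixes W :: "'x::finite \<Rightarrow> 'a::finite \<Rightarrow> real"
  assumes "channel W"
  shows "\<exists>Q. distr Q \<and> abs_cont Q W \<and> (\<forall>Q'. distr Q' \<and> abs_cont Q' W \<longrightarrow> objective Q' W \<le> objective Q W)"
proof -
  have W: "\<And>x a. 0 \<le> W x a" using assms by (auto simp: channel_def)
  let ?S = "{Q :: 'x \<times> 'a \<Rightarrow> real. distr Q} \<inter> {Q. abs_cont Q W}"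
  have "closed {Q :: 'x \<times> 'a \<Rightarrow> real. abs_cont Q W}"
    unfolding abs_cont_def
    by (intro closed_Collect_all closed_Collect_imp closed_Collect_eq open_Collect_const
        continuous_intros continuous_on_product_coordinates)
  then have "compact ?S"
    using compact_distr by (rule compact_Int_closed[rotated])
  moreover have "(\<lambda>(x, a). W x a / real (card (UNIV :: 'x set))) \<in> ?S"
    using assms by (auto simp: distr_def abs_cont_def channel_def sum_UNIV_prod sum_divide_distrib[symmetric])
  then have "?S \<noteq> {}" by blast
  moreover have "continuous_on ?S (\<lambda>Q. (- (\<Sum>a\<in>UNIV. marg_A Q a * ln (marg_A Q a))
      + (\<Sum>x\<in>UNIV. marg_X Q x * ln (marg_X Q x)) - (\<Sum>u\<in>UNIV. Q u * ln (Q u))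
      + 2 * (\<Sum>x\<in>UNIV. \<Sum>a\<in>UNIV. Q (x, a) * ln (W x a))) / ln 2)"
    unfolding marg_A_def marg_X_def
    by (intro continuous_intros continuous_on_subset[OF continuous_on_product_coordinates])
      (auto simp: distr_def intro: sum_nonneg)
  then have "continuous_on ?S (\<lambda>Q. objective Q W)"
    by (rule continuous_on_eq) (subst objective_ln(2)[symmetric]; simp add: W)
  ultimately obtain Q where "Q \<in> ?S" "\<forall>Q'\<in>?S. objective Q' W \<le> objective Q W"
    by (metis continuous_attains_sup)
  then show ?thesis by blast
qed

section \<open>First-order optimality at a maximizer\<close>

lemma ln_tangent_le:
  fixes p P r :: real
  assumes "0 \<le> p" "p \<le> P" "0 < r"
  shows "p * ln r \<le> p * ln (p / P) + (r * P - p)"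
proof (cases "p = 0")
  case False
  then have pos: "0 < p" "0 < P" using assms by auto
  have "ln (r * P / p) \<le> r * P / p - 1"
    using pos assms by (intro ln_le_minus_one) auto
  moreover have "ln (r * P / p) = ln r - ln (p / P)"
    using pos assms by (simp add: ln_div ln_mult)
  ultimately have "p * (ln r - ln (p / P)) \<le> p * (r * P / p - 1)"
    using pos by (intro mult_left_mono) auto
  also have "\<dots> = r * P - p"
    using pos by (simp add: right_diff_distrib)
  finally show ?thesis by (simp add: right_diff_distrib)
qed (use assms in auto)

text \<open>The log-sum inequality for two terms. Both pairs are compared with the same tangent, at
  the mixed ratio \<open>r = m / M\<close>, and the affine errors of \<open>ln_tangent_le\<close>
  then combine to \<open>r * M - m = 0\<close>.\<close>

lemma perspective_convex:
  fixes p P q R e :: real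
  assumes p: "0 \<le> p" "p \<le> P" and q: "0 \<le> q" "q \<le> R" and e: "0 < e" "e < 1"
  defines "m \<equiv> (1 - e) * p + e * q" and "M \<equiv> (1 - e) * P + e * R"
  shows "m * ln (m / M) \<le> (1 - e) * (p * ln (p / P)) + e * (q * ln (q / R))"
proof (cases "m = 0")
  case True
  then have "p = 0" "q = 0"
    using p q e by (auto simp: m_def add_nonneg_eq_0_iff)
  then show ?thesis using True by simp
next
  case False
  have "0 \<le> m" "m \<le> M"
    using p q e by (auto simp: m_def M_def intro!: add_mono mult_left_mono)
  then have pos: "0 < m" "0 < M" using False by auto
  define r where "r = m / M"
  have r: "0 < r" using pos by (simp add: r_def)
  have "m * ln r = (1 - e) * (p * ln r) + e * (q * ln r)"
    by (simp add: m_def algebra_simps)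
  also have "\<dots> \<le> (1 - e) * (p * ln (p / P) + (r * P - p)) + e * (q * ln (q / R) + (r * R - q))"
    using e by (intro add_mono mult_left_mono ln_tangent_le p q r) auto
  also have "\<dots> = (1 - e) * (p * ln (p / P)) + e * (q * ln (q / R)) + (r * M - m)"
    by (simp add: m_def M_def algebra_simps)
  finally show ?thesis using pos by (simp add: r_def)
qed

text \<open>Moving a little mass of the maximizer to the input \<open>x0\<close>, with output distribution \<open>s\<close>,
  yields the first-order optimality condition. Concavity of \<open>H(A|X) + H(A)\<close> makes it exact
  for every \<open>e\<close>, with the output marginal of the perturbed distribution.\<close>

lemma maximizer_perturbation:
  fixes W :: "'x::finite \<Rightarrow> 'a::finite \<Rightarrow> real"
  assumes W: "\<And>x a. 0 \<le> W x a" and Q: "distr Q" "abs_cont Q W"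
    and max: "\<And>Q'. distr Q' \<Longrightarrow> abs_cont Q' W \<Longrightarrow> objective Q' W \<le> objective Q W"
    and s: "distr s" "\<And>a. W x0 a = 0 \<Longrightarrow> s a = 0" and e: "0 < e" "e < 1"
  shows "(\<Sum>a\<in>UNIV. s a * (2 * ln (W x0 a) - ln (s a) - ln ((1 - e) * marg_A Q a + e * s a)))
    \<le> objective Q W * ln 2"
proof -
  define R :: "'x \<Rightarrow> real" where "R x = (if x = x0 then 1 else 0)" for x
  define T where "T = (\<lambda>(x, a). (1 - e) * Q (x, a) + e * (R x * s a))"
  define t where "t a = (1 - e) * marg_A Q a + e * s a" for a
  have s0: "0 \<le> s a" and s1: "(\<Sum>a\<in>UNIV. s a) = 1" for a
    using s by (auto simp: distr_def)
  have sR: "(\<Sum>x\<in>UNIV. R x * f x) = f x0" for f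
    by (simp add: R_def if_distrib[of "\<lambda>z. z * _"] cong: if_cong)
  have R1: "(\<Sum>x\<in>UNIV. R x) = 1" by (simp add: R_def)
  have mX: "marg_X T x = (1 - e) * marg_X Q x + e * R x" for x
    by (simp add: T_def marg_X_def sum.distrib sum_distrib_left[symmetric] s1)
  have mA: "marg_A T a = t a" for a
    by (simp add: T_def t_def marg_A_def sum.distrib sum_distrib_left[symmetric] sum_distrib_right[symmetric] R1)
  have T: "distr T" "abs_cont T W"
  proof -
    have "(\<Sum>u\<in>UNIV. T u) = (\<Sum>x\<in>UNIV. marg_X T x)"
      by (simp add: sum_UNIV_prod marg_X_def)
    also have "\<dots> = 1"
      by (simp add: mX sum.distrib sum_distrib_left[symmetric] sum_marg[OF Q(1)] R1)
    finally show "distr T"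
      using e s0 distr_le_marg(1)[OF Q(1)] by (auto simp: distr_def T_def R_def)
    show "abs_cont T W"
      using Q(2) s(2) by (auto simp: abs_cont_def T_def R_def)
  qed
  define C where "C = (\<Sum>x\<in>UNIV. \<Sum>a\<in>UNIV. Q (x, a) * ln (Q (x, a) / marg_X Q x))"
  define L where "L = (\<Sum>x\<in>UNIV. \<Sum>a\<in>UNIV. Q (x, a) * ln (W x a))"
  define H where "H = (\<Sum>a\<in>UNIV. marg_A Q a * ln (marg_A Q a))"
  define G where "G = objective Q W * ln 2"
  have G: "G = - H - C + 2 * L"
    unfolding G_def H_def C_def L_def by (rule objective_ln(1)[OF Q W])
  have C': "(\<Sum>x\<in>UNIV. \<Sum>a\<in>UNIV. T (x, a) * ln (T (x, a) / marg_X T x))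
    \<le> (1 - e) * C + e * (\<Sum>a\<in>UNIV. s a * ln (s a))"
  proof -
    have "(\<Sum>x\<in>UNIV. \<Sum>a\<in>UNIV. T (x, a) * ln (T (x, a) / marg_X T x))
      \<le> (\<Sum>x\<in>UNIV. \<Sum>a\<in>UNIV. (1 - e) * (Q (x, a) * ln (Q (x, a) / marg_X Q x))
          + e * (R x * s a * ln (R x * s a / R x)))"
      unfolding mX unfolding T_def case_prod_conv
    proof (intro sum_mono perspective_convex e distr_le_marg[OF Q(1)])
      show "0 \<le> R x * s a" "R x * s a \<le> R x" for x a
        using s0[of a] member_le_sum[of a UNIV s] s0 s1 by (auto simp: R_def)
    qed
    also have "\<dots> = (1 - e) * C + e * (\<Sum>x\<in>UNIV. \<Sum>a\<in>UNIV. R x * s a * ln (R x * s a / R x))"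
      by (simp only: C_def sum.distrib sum_distrib_left)
    also have "(\<Sum>x\<in>UNIV. \<Sum>a\<in>UNIV. R x * s a * ln (R x * s a / R x)) = (\<Sum>x\<in>UNIV. R x * (\<Sum>a\<in>UNIV. s a * ln (s a)))"
      by (intro sum.cong refl) (simp add: R_def)
    finally show ?thesis by (simp only: sR)
  qed
  have L': "(\<Sum>x\<in>UNIV. \<Sum>a\<in>UNIV. T (x, a) * ln (W x a)) = (1 - e) * L + e * (\<Sum>a\<in>UNIV. s a * ln (W x0 a))"
  proof -
    have "(\<Sum>x\<in>UNIV. \<Sum>a\<in>UNIV. T (x, a) * ln (W x a))
      = (1 - e) * L + e * (\<Sum>x\<in>UNIV. R x * (\<Sum>a\<in>UNIV. s a * ln (W x a)))"
      by (simp add: T_def L_def distrib_right sum.distrib sum_distrib_left mult.assoc)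
    then show ?thesis by (simp only: sR)
  qed
  \<comment> \<open>Only the share of \<open>t\<close> that comes from \<open>marg_A Q\<close> is
    estimated, by Gibbs' inequality: the tangent bound at \<open>P = 1\<close>, with errors
    \<open>t a - marg_A Q a\<close> that sum to zero. The share of \<open>s\<close> keeps
    \<open>ln (t a)\<close>, so the perturbed marginal stays in the conclusion.\<close>
  have H': "(\<Sum>a\<in>UNIV. t a * ln (t a)) \<le> (1 - e) * H + e * (\<Sum>a\<in>UNIV. s a * ln (t a))"
  proof -
    have "marg_A Q a * ln (t a) \<le> marg_A Q a * ln (marg_A Q a) + (t a - marg_A Q a)" for a
    proof (cases "marg_A Q a = 0")
      case False
      then have "0 < marg_A Q a" using marg_nonneg(2)[OF Q(1), of a] by simp
      moreover from this have "0 < t a" using e s0[of a] by (auto simp: t_def intro: add_pos_nonneg)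
      moreover have "marg_A Q a \<le> 1"
        using member_le_sum[of a UNIV "marg_A Q"] marg_nonneg(2)[OF Q(1)] sum_marg(2)[OF Q(1)] by simp
      ultimately show ?thesis using ln_tangent_le[of "marg_A Q a" 1 "t a"] by simp
    next
      case True
      then show ?thesis using e s0[of a] by (simp add: t_def)
    qed
    then have "(\<Sum>a\<in>UNIV. marg_A Q a * ln (t a))
      \<le> (\<Sum>a\<in>UNIV. marg_A Q a * ln (marg_A Q a) + (t a - marg_A Q a))"
      by (intro sum_mono)
    also have "\<dots> = H"
      by (simp add: H_def t_def sum.distrib sum_subtractf sum_distrib_left[symmetric] sum_marg[OF Q(1)] s1)
    finally have "(1 - e) * (\<Sum>a\<in>UNIV. marg_A Q a * ln (t a)) \<le> (1 - e) * H"
      using e by (intro mult_left_mono) auto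
    moreover have "(\<Sum>a\<in>UNIV. t a * ln (t a))
      = (1 - e) * (\<Sum>a\<in>UNIV. marg_A Q a * ln (t a)) + e * (\<Sum>a\<in>UNIV. s a * ln (t a))"
      unfolding sum_distrib_left sum.distrib[symmetric]
      by (intro sum.cong refl) (simp add: t_def algebra_simps)
    ultimately show ?thesis by linarith
  qed
  let ?D = "2 * (\<Sum>a\<in>UNIV. s a * ln (W x0 a)) - (\<Sum>a\<in>UNIV. s a * ln (s a)) - (\<Sum>a\<in>UNIV. s a * ln (t a))"
  have "objective T W * ln 2 \<le> G"
    unfolding G_def using max[OF T] by (intro mult_right_mono) auto
  moreover have "objective T W * ln 2 \<ge> (1 - e) * G + e * ?D"
    unfolding objective_ln(1)[OF T W] mA L' using C' H'
    by (simp add: G algebra_simps)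
  ultimately have "e * ?D \<le> e * G" by (simp add: algebra_simps)
  then have "?D \<le> G" using e by simp
  then show ?thesis
    by (simp add: G_def t_def sum_subtractf right_diff_distrib sum_distrib_left mult.left_commute)
qed

lemma maximizer_marg_A_support:
  fixes W :: "'x::finite \<Rightarrow> 'a::finite \<Rightarrow> real"
  assumes W: "\<And>x a. 0 \<le> W x a" and Q: "distr Q" "abs_cont Q W"
    and max: "\<And>Q'. distr Q' \<Longrightarrow> abs_cont Q' W \<Longrightarrow> objective Q' W \<le> objective Q W"
    and a: "marg_A Q a = 0"
  shows "W x a = 0"
proof (rule ccontr)
  assume Wa: "W x a \<noteq> 0"
  define s :: "'a \<Rightarrow> real" where "s b = (if b = a then 1 else 0)" for b
  define D where "D = 2 * ln (W x a) - objective Q W * ln 2"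
  \<comment> \<open>This makes \<open>D - ln e \<ge> 1\<close>, whereas the perturbation bound says
    \<open>D - ln e \<le> 0\<close>.\<close>
  define e where "e = exp (- \<bar>D\<bar> - 1)"
  have "(\<Sum>b\<in>UNIV. s b * (2 * ln (W x b) - ln (s b) - ln ((1 - e) * marg_A Q b + e * s b)))
    \<le> objective Q W * ln 2"
    by (rule maximizer_perturbation[OF W Q max]) (use Wa in \<open>auto simp: s_def e_def distr_def\<close>)
  moreover have "(\<Sum>b\<in>UNIV. s b * (2 * ln (W x b) - ln (s b) - ln ((1 - e) * marg_A Q b + e * s b)))
    = 2 * ln (W x a) - ln e"
    unfolding s_def by (simp add: if_distrib[of "\<lambda>z. z * _"] a cong: if_cong)
  ultimately show False by (simp add: e_def D_def)
qed

text \<open>For vanishing perturbation the optimality condition bounds the sum of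
  \<open>s a * ln ((W x a)\<^sup>2 / (t a * s a))\<close> for every admissible output law
  \<open>s\<close>, with \<open>t\<close> the output marginal. By the Gibbs variational principle
  the best \<open>s\<close> is proportional to \<open>(W x a)\<^sup>2 / t a\<close>, and there the
  sum equals \<open>ln Z\<close>.\<close>

lemma maximizer_renyi_bound:
  fixes W :: "'x::finite \<Rightarrow> 'a::finite \<Rightarrow> real"
  assumes ch: "channel W" and Q: "distr Q" "abs_cont Q W"
    and max: "\<And>Q'. distr Q' \<Longrightarrow> abs_cont Q' W \<Longrightarrow> objective Q' W \<le> objective Q W"
  shows "(\<Sum>a\<in>UNIV. (W x a)\<^sup>2 / marg_A Q a) \<le> 2 powr objective Q W"
proof -
  have W: "\<And>x a. 0 \<le> W x a" using ch by (auto simp: channel_def)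
  let ?t = "marg_A Q"
  have t: "0 < ?t a" if "W x a \<noteq> 0" for a
    using maximizer_marg_A_support[OF W Q max, of a x] marg_nonneg(2)[OF Q(1), of a] that by force
  define Z where "Z = (\<Sum>a\<in>UNIV. (W x a)\<^sup>2 / ?t a)"
  have nn: "0 \<le> (W x a)\<^sup>2 / ?t a" for a
    using marg_nonneg(2)[OF Q(1), of a] by simp
  obtain a0 where a0: "W x a0 \<noteq> 0"
    using ch by (metis channel_def sum.neutral zero_neq_one)
  have "0 < Z"
    unfolding Z_def by (rule sum_pos2[of _ a0]) (use a0 t[OF a0] nn in auto)
  define s where "s a = (W x a)\<^sup>2 / ?t a / Z" for a
  have s: "distr s" "\<And>a. W x a = 0 \<Longrightarrow> s a = 0"
    using nn \<open>0 < Z\<close>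
    by (auto simp: distr_def s_def sum_divide_distrib[symmetric] Z_def[symmetric]
        simp del: divide_divide_eq_left intro!: divide_nonneg_pos)
  let ?F = "\<lambda>e. \<Sum>a\<in>UNIV. s a * (2 * ln (W x a) - ln (s a) - ln ((1 - e) * ?t a + e * s a))"
  \<comment> \<open>The limit is written with 0 in place of \<open>e\<close>, as the limit rules
    produce it. Where \<open>W x a\<close> is zero, so is the summand; elsewhere the marginal is
    positive and \<open>ln\<close> is continuous.\<close>
  have "(?F \<longlongrightarrow> (\<Sum>a\<in>UNIV. s a * (2 * ln (W x a) - ln (s a) - ln ((1 - 0) * ?t a + 0 * s a)))) (at_right 0)"
  proof (rule tendsto_sum)
    fix a
    show "((\<lambda>e. s a * (2 * ln (W x a) - ln (s a) - ln ((1 - e) * ?t a + e * s a))) \<longlongrightarrow>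
      s a * (2 * ln (W x a) - ln (s a) - ln ((1 - 0) * ?t a + 0 * s a))) (at_right 0)"
    proof (cases "W x a = 0")
      case False
      then show ?thesis using t[of a] by (intro tendsto_intros) auto
    qed (simp add: s(2))
  qed
  moreover have "eventually (\<lambda>e. ?F e \<le> objective Q W * ln 2) (at_right 0)"
    unfolding eventually_at_right_field
    using maximizer_perturbation[OF W Q max s] by (intro exI[of _ 1]) auto
  ultimately have le: "(\<Sum>a\<in>UNIV. s a * (2 * ln (W x a) - ln (s a) - ln ((1 - 0) * ?t a + 0 * s a))) \<le> objective Q W * ln 2"
    by (rule tendsto_upperbound) simp
  have eq: "(\<Sum>a\<in>UNIV. s a * (2 * ln (W x a) - ln (s a) - ln ((1 - 0) * ?t a + 0 * s a))) = (\<Sum>a\<in>UNIV. s a * ln Z)"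
  proof (intro sum.cong refl)
    fix a
    show "s a * (2 * ln (W x a) - ln (s a) - ln ((1 - 0) * ?t a + 0 * s a)) = s a * ln Z"
    proof (cases "W x a = 0")
      case False
      then have "0 < W x a" using W[of x a] by simp
      then have "ln (s a) = 2 * ln (W x a) - ln (?t a) - ln Z"
        using t[OF False] \<open>0 < Z\<close> by (simp add: s_def ln_div ln_mult ln_realpow)
      then show ?thesis by simp
    qed (simp add: s(2))
  qed
  have "ln Z \<le> objective Q W * ln 2"
    using le[unfolded eq] s(1) by (simp add: sum_distrib_right[symmetric] distr_def)
  then have "Z \<le> exp (objective Q W * ln 2)"
    using \<open>0 < Z\<close> by (metis exp_le_cancel_iff exp_ln)
  then show ?thesis by (simp add: powr_def Z_def)
qed

section \<open>The no-signalling upper bound\<close>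

lemma ns_boxesD:
  fixes Q :: "'x::finite list \<Rightarrow> 'x list \<Rightarrow> 'a::finite list \<Rightarrow> 'a list \<Rightarrow> real"
  assumes Q: "Q \<in> ns_boxes n"
  shows "\<lbrakk>y \<in> seqs n; z \<in> seqs n; a \<in> seqs n; b \<in> seqs n\<rbrakk> \<Longrightarrow> 0 \<le> Q y z a b"
    and "\<lbrakk>a \<in> seqs n; b \<in> seqs n\<rbrakk> \<Longrightarrow> (\<Sum>y\<in>seqs n. \<Sum>z\<in>seqs n. Q y z a b) = 1"
    and "\<lbrakk>z \<in> seqs n; a \<in> seqs n; a' \<in> seqs n; b \<in> seqs n\<rbrakk> \<Longrightarrow>
      (\<Sum>y\<in>seqs n. Q y z a b) = (\<Sum>y\<in>seqs n. Q y z a' b)"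
    and "\<lbrakk>y \<in> seqs n; a \<in> seqs n; b \<in> seqs n; b' \<in> seqs n\<rbrakk> \<Longrightarrow>
      (\<Sum>z\<in>seqs n. Q y z a b) = (\<Sum>z\<in>seqs n. Q y z a b')"
proof -
  note F = Q[unfolded ns_boxes_def mem_Collect_eq]
  note F' = F[THEN conjunct2, THEN conjunct2]
  show "\<lbrakk>y \<in> seqs n; z \<in> seqs n; a \<in> seqs n; b \<in> seqs n\<rbrakk> \<Longrightarrow> 0 \<le> Q y z a b"
    by (rule F[THEN conjunct1, rule_format])
  show "\<lbrakk>a \<in> seqs n; b \<in> seqs n\<rbrakk> \<Longrightarrow> (\<Sum>y\<in>seqs n. \<Sum>z\<in>seqs n. Q y z a b) = 1"
    by (rule F[THEN conjunct2, THEN conjunct1, rule_format])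
  show "\<lbrakk>z \<in> seqs n; a \<in> seqs n; a' \<in> seqs n; b \<in> seqs n\<rbrakk> \<Longrightarrow>
      (\<Sum>y\<in>seqs n. Q y z a b) = (\<Sum>y\<in>seqs n. Q y z a' b)"
    by (rule F'[THEN conjunct1, rule_format])
  show "\<lbrakk>y \<in> seqs n; a \<in> seqs n; b \<in> seqs n; b' \<in> seqs n\<rbrakk> \<Longrightarrow>
      (\<Sum>z\<in>seqs n. Q y z a b) = (\<Sum>z\<in>seqs n. Q y z a b')"
    by (rule F'[THEN conjunct2, rule_format])
qed

text \<open>Each marginal is taken at an arbitrary reference input \<open>c\<close> of the other
  player. No-signalling makes this choice immaterial, so every entry of the box lies below both
  marginals although each of them sees only one input.\<close>

lemma ns_box_marginals:
  fixes Q :: "'x::finite list \<Rightarrow> 'x list \<Rightarrow> 'a::finite list \<Rightarrow> 'a list \<Rightarrow> real"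
  assumes Q: "Q \<in> ns_boxes n"
  obtains q r where
    "\<And>y z a b. \<lbrakk>y \<in> seqs n; z \<in> seqs n; a \<in> seqs n; b \<in> seqs n\<rbrakk> \<Longrightarrow> Q y z a b \<le> q y a \<and> Q y z a b \<le> r z b"
    "\<And>a. a \<in> seqs n \<Longrightarrow> (\<Sum>y\<in>seqs n. q y a) = 1" "\<And>b. b \<in> seqs n \<Longrightarrow> (\<Sum>z\<in>seqs n. r z b) = 1"
    "\<And>y a. y \<in> seqs n \<Longrightarrow> a \<in> seqs n \<Longrightarrow> 0 \<le> q y a" "\<And>z b. z \<in> seqs n \<Longrightarrow> b \<in> seqs n \<Longrightarrow> 0 \<le> r z b"
proof -
  obtain c :: "'a list" where c: "c \<in> seqs n" using seqs_nonempty by blast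
  note nn = ns_boxesD(1)[OF Q] and tot = ns_boxesD(2)[OF Q]
  note q = ns_boxesD(4)[OF Q _ _ _ c] and r = ns_boxesD(3)[OF Q _ _ c]
  show thesis
  proof (rule that[of "\<lambda>y a. \<Sum>z\<in>seqs n. Q y z a c" "\<lambda>z b. \<Sum>y\<in>seqs n. Q y z c b"])
    fix y z :: "'x list" and a b :: "'a list"
    assume *: "y \<in> seqs n" "z \<in> seqs n" "a \<in> seqs n" "b \<in> seqs n"
    have "Q y z a b \<le> (\<Sum>z\<in>seqs n. Q y z a b)" "Q y z a b \<le> (\<Sum>y\<in>seqs n. Q y z a b)"
      by (rule member_le_sum; use * nn in simp)+
    then show "Q y z a b \<le> (\<Sum>z\<in>seqs n. Q y z a c) \<and> Q y z a b \<le> (\<Sum>y\<in>seqs n. Q y z c b)"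
      by (simp only: q[OF *(1,3,4)] r[OF *(2,3) *(4)] simp_thms)
  next
    show "(\<Sum>z\<in>seqs n. \<Sum>y\<in>seqs n. Q y z c b) = 1" if "b \<in> seqs n" for b
      using tot[OF c that] by (subst sum.swap)
  qed (use tot c in \<open>auto intro!: sum_nonneg nn\<close>)
qed

text \<open>If \<open>\<Sum>a. W(a|x)\<^sup>2 / t(a) \<le> K\<close> for every \<open>x\<close>, then by AM-GM
  \<open>W(a|x) W(b|x) \<le> (t(a) W(b|x)\<^sup>2 / t(b) + t(b) W(a|x)\<^sup>2 / t(a)) / 2\<close>; in the first term the
  box is bounded by its first marginal, in the second by the other one.
  Both sides of the hypothesis are multiplicative, so no error term in \<open>n\<close> appears.\<close>

lemma ns_value_le:
  fixes W :: "'x::finite \<Rightarrow> 'a::finite \<Rightarrow> real" and t :: "'a \<Rightarrow> real"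
  assumes W: "\<And>x a. 0 \<le> W x a" and t: "distr t" and ac: "\<And>x a. t a = 0 \<Longrightarrow> W x a = 0"
    and K: "\<And>x. (\<Sum>a\<in>UNIV. (W x a)\<^sup>2 / t a) \<le> K"
    and Q: "Q \<in> ns_boxes n"
  shows "game_sum W n (\<lambda>xs us vs. Q xs xs us vs) \<le> (K / real (card (UNIV :: 'x set))) ^ n"
proof -
  obtain q r where qr:
    "\<And>y z a b. \<lbrakk>y \<in> seqs n; z \<in> seqs n; a \<in> seqs n; b \<in> seqs n\<rbrakk> \<Longrightarrow> Q y z a b \<le> q y a \<and> Q y z a b \<le> r z b"
    "\<And>a. a \<in> seqs n \<Longrightarrow> (\<Sum>y\<in>seqs n. q y a) = 1" "\<And>b. b \<in> seqs n \<Longrightarrow> (\<Sum>z\<in>seqs n. r z b) = 1"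
    "\<And>y a. y \<in> seqs n \<Longrightarrow> a \<in> seqs n \<Longrightarrow> 0 \<le> q y a" "\<And>z b. z \<in> seqs n \<Longrightarrow> b \<in> seqs n \<Longrightarrow> 0 \<le> r z b"
    using ns_box_marginals[OF Q] by blast
  define R where "R = seqprod (\<lambda>x a. (W x a)\<^sup>2 / t a) n"
  define T where "T us = (\<Prod>i<n. t (us ! i))" for us
  have t0: "0 \<le> t a" for a using t by (simp add: distr_def)
  have R0: "0 \<le> R xs us" for xs us
    unfolding R_def by (intro seqprod_nonneg) (simp add: t0)
  have T0: "0 \<le> T us" for us by (simp add: T_def prod_nonneg t0)
  have T1: "(\<Sum>us\<in>seqs n. T us) = 1"
    using t sum_seqs_prod[of "\<lambda>_. t" n] by (simp add: T_def distr_def)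
  have RK: "(\<Sum>vs\<in>seqs n. R xs vs) \<le> K ^ n" for xs
  proof -
    have "(\<Sum>vs\<in>seqs n. R xs vs) \<le> (\<Prod>i<n. K)"
      unfolding R_def sum_seqprod by (intro prod_mono conjI K sum_nonneg) (simp add: t0)
    then show ?thesis by simp
  qed
  have RT: "(seqprod W n xs us)\<^sup>2 = R xs us * T us" for xs us
  proof -
    have "(W x a)\<^sup>2 = (W x a)\<^sup>2 / t a * t a" for x a
      using ac[of a x] by (cases "t a = 0") auto
    then show ?thesis
      by (simp add: seqprod_def R_def T_def prod_power_distrib prod.distrib[symmetric])
  qed
  \<comment> \<open>By \<open>RT\<close> the left side is the geometric mean of the two crossed
    terms. In each of them \<open>R\<close> and \<open>T\<close> sit at outputs of different
    players, so one output can be summed out before the marginal of the other player is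
    used.\<close>
  have WW: "seqprod W n xs us * seqprod W n xs vs \<le> (R xs vs * T us + R xs us * T vs) / 2" for xs us vs
  proof (rule power2_le_imp_le)
    have "(seqprod W n xs us * seqprod W n xs vs)\<^sup>2 = (R xs vs * T us) * (R xs us * T vs)"
      by (simp add: power_mult_distrib RT)
    also have "\<dots> \<le> ((R xs vs * T us + R xs us * T vs) / 2)\<^sup>2"
      using arith_geo_mean_sqrt[of "R xs vs * T us" "R xs us * T vs"] R0 T0
      by (intro sqrt_le_D) simp
    finally show "(seqprod W n xs us * seqprod W n xs vs)\<^sup>2 \<le> ((R xs vs * T us + R xs us * T vs) / 2)\<^sup>2" .
  qed (simp add: R0 T0)
  \<comment> \<open>The order of summation matters: \<open>vs\<close> costs \<open>K ^ n\<close>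
    uniformly in \<open>xs\<close>, then \<open>p\<close> has total mass one over \<open>xs\<close>,
    and finally \<open>T\<close> has total mass one over \<open>us\<close>.\<close>
  have half: "(\<Sum>xs\<in>seqs n. \<Sum>us\<in>seqs n. \<Sum>vs\<in>seqs n. R xs vs * T us * p xs us) \<le> K ^ n"
    if p: "\<And>us. us \<in> seqs n \<Longrightarrow> (\<Sum>xs\<in>seqs n. p xs us) = 1"
      "\<And>xs us. xs \<in> seqs n \<Longrightarrow> us \<in> seqs n \<Longrightarrow> 0 \<le> p xs us" for p
  proof -
    have "(\<Sum>xs\<in>seqs n. \<Sum>us\<in>seqs n. \<Sum>vs\<in>seqs n. R xs vs * T us * p xs us)
      = (\<Sum>xs\<in>seqs n. \<Sum>us\<in>seqs n. (\<Sum>vs\<in>seqs n. R xs vs) * (T us * p xs us))"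
      by (simp add: sum_distrib_right mult.assoc)
    also have "\<dots> \<le> (\<Sum>xs\<in>seqs n. \<Sum>us\<in>seqs n. K ^ n * (T us * p xs us))"
      by (intro sum_mono mult_right_mono RK mult_nonneg_nonneg T0 p)
    also have "\<dots> = K ^ n * (\<Sum>us\<in>seqs n. T us * (\<Sum>xs\<in>seqs n. p xs us))"
      unfolding sum_distrib_left by (rule sum.swap)
    also have "\<dots> = K ^ n" by (simp add: p T1)
    finally show ?thesis .
  qed
  let ?c = "(1 / real (card (UNIV :: 'x set))) ^ n"
  have "game_sum W n (\<lambda>xs us vs. Q xs xs us vs)
    = ?c * (\<Sum>xs\<in>seqs n. \<Sum>us\<in>seqs n. \<Sum>vs\<in>seqs n. seqprod W n xs us * seqprod W n xs vs * Q xs xs us vs)"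
    by (simp add: game_sum_def Pn_eq_seqprod sum_distrib_left mult.assoc)
  also have "\<dots> \<le> ?c * (\<Sum>xs\<in>seqs n. \<Sum>us\<in>seqs n. \<Sum>vs\<in>seqs n.
      (R xs vs * T us * q xs us + R xs us * T vs * r xs vs) / 2)"
  proof (intro mult_left_mono sum_mono)
    fix xs :: "'x list" and us vs :: "'a list"
    assume *: "xs \<in> seqs n" "us \<in> seqs n" "vs \<in> seqs n"
    have "0 \<le> Q xs xs us vs" using ns_boxesD(1)[OF Q] * by simp
    then have "seqprod W n xs us * seqprod W n xs vs * Q xs xs us vs
      \<le> (R xs vs * T us + R xs us * T vs) / 2 * Q xs xs us vs"
      by (intro mult_right_mono WW)
    also have "\<dots> = (R xs vs * T us * Q xs xs us vs + R xs us * T vs * Q xs xs us vs) / 2"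
      by (simp add: algebra_simps)
    also have "\<dots> \<le> (R xs vs * T us * q xs us + R xs us * T vs * r xs vs) / 2"
      using qr(1)[OF *(1,1,2,3)] by (intro divide_right_mono add_mono mult_left_mono mult_nonneg_nonneg R0 T0) auto
    finally show "seqprod W n xs us * seqprod W n xs vs * Q xs xs us vs \<le> \<dots>" .
  qed simp
  also have "\<dots> = ?c * (((\<Sum>xs\<in>seqs n. \<Sum>us\<in>seqs n. \<Sum>vs\<in>seqs n. R xs vs * T us * q xs us)
      + (\<Sum>xs\<in>seqs n. \<Sum>us\<in>seqs n. \<Sum>vs\<in>seqs n. R xs us * T vs * r xs vs)) / 2)"
    by (simp add: sum_divide_distrib[symmetric] sum.distrib)
  also have "(\<Sum>xs\<in>seqs n. \<Sum>us\<in>seqs n. \<Sum>vs\<in>seqs n. R xs us * T vs * r xs vs)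
    = (\<Sum>xs\<in>seqs n. \<Sum>vs\<in>seqs n. \<Sum>us\<in>seqs n. R xs us * T vs * r xs vs)"
    by (intro sum.cong refl sum.swap)
  also have "?c * (((\<Sum>xs\<in>seqs n. \<Sum>us\<in>seqs n. \<Sum>vs\<in>seqs n. R xs vs * T us * q xs us) + \<dots>) / 2)
    \<le> ?c * ((K ^ n + K ^ n) / 2)"
    by (intro mult_left_mono divide_right_mono add_mono half qr) auto
  also have "\<dots> = (K / real (card (UNIV :: 'x set))) ^ n"
    by (simp add: power_divide)
  finally show ?thesis .
qed

section \<open>Quantum strategies are no-signalling\<close>

definition hform :: "nat \<Rightarrow> (nat \<Rightarrow> nat \<Rightarrow> complex) \<Rightarrow> (nat \<Rightarrow> complex) \<Rightarrow> complex" where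
  "hform d A v = (\<Sum>i<d. \<Sum>j<d. cnj (v i) * A i j * v j)"

text \<open>Matrices and vectors are bare functions, of which \<open>hform\<close> sees only the
  indices below \<open>d\<close>. Changing a coordinate or subtracting a rank-one matrix then raises
  no carrier conditions.\<close>

definition hpos :: "nat \<Rightarrow> (nat \<Rightarrow> nat \<Rightarrow> complex) \<Rightarrow> bool" where
  "hpos d A \<longleftrightarrow> (\<forall>v. Im (hform d A v) = 0 \<and> 0 \<le> Re (hform d A v))"

lemma psd_imp_hpos:
  assumes "psd d A"
  shows "hpos d (\<lambda>i j. A $$ (i, j))"
  unfolding hpos_def
proof
  fix v :: "nat \<Rightarrow> complex"
  have "vec d v \<in> carrier_vec d" by simp
  with assms have "let q = hform d (\<lambda>i j. A $$ (i, j)) v in Im q = 0 \<and> 0 \<le> Re q"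
    unfolding psd_def hform_def by (auto dest!: bspec[of _ _ "vec d v"] simp: Let_def)
  then show "Im (hform d (\<lambda>i j. A $$ (i, j)) v) = 0 \<and> 0 \<le> Re (hform d (\<lambda>i j. A $$ (i, j)) v)"
    by (simp add: Let_def)
qed

lemma hform_add_unit:
  assumes "k < d"
  shows "hform d A (\<lambda>i. v i + (if i = k then c else 0)) =
    hform d A v + cnj c * (\<Sum>j<d. A k j * v j) + c * (\<Sum>i<d. cnj (v i) * A i k) + cnj c * c * A k k"
proof -
  define u where "u i = (if i = k then c else 0)" for i
  have u: "(\<Sum>j<d. F j * u j) = F k * c" "(\<Sum>i<d. cnj (u i) * F i) = cnj c * F k" for F :: "nat \<Rightarrow> complex"
    using assms by (simp_all add: u_def if_distrib[of cnj] if_distrib[of "\<lambda>z. z * _"] if_distrib[of "\<lambda>z. _ * z"] cong: if_cong)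
  have "hform d A (\<lambda>i. v i + u i) = hform d A v + (\<Sum>i<d. cnj (u i) * (\<Sum>j<d. A i j * v j))
    + (\<Sum>i<d. \<Sum>j<d. cnj (v i) * A i j * u j) + (\<Sum>i<d. cnj (u i) * (\<Sum>j<d. A i j * u j))"
    by (simp add: hform_def sum.distrib[symmetric] sum_distrib_left algebra_simps)
  then show ?thesis
    by (simp only: u) (simp add: u_def sum_distrib_left mult_ac)
qed

lemma hform_unit:
  assumes "k < d"
  shows "hform d A (\<lambda>i. if i = k then c else 0) = cnj c * c * A k k"
  using hform_add_unit[OF assms, of A "\<lambda>_. 0" c] by (simp add: hform_def)

lemma hform_two_units:
  assumes "j < d" "k < d"
  shows "hform d A (\<lambda>i. (if i = j then 1 else 0) + (if i = k then c else 0)) =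
    A j j + cnj c * A k j + c * A j k + cnj c * c * A k k"
  using assms hform_unit[of j d A 1]
  by (simp add: hform_add_unit if_distrib[of cnj] if_distrib[of "\<lambda>z. z * _"] if_distrib[of "\<lambda>z. _ * z"] cong: if_cong)

lemma hpos_diag:
  assumes "hpos d A" "k < d"
  shows "Im (A k k) = 0" "0 \<le> Re (A k k)"
  using assms(1)[unfolded hpos_def, THEN spec, of "\<lambda>i. if i = k then 1 else 0"]
  unfolding hform_unit[OF assms(2)] by simp_all

lemma hpos_hermitian:
  assumes "hpos d A" "j < d" "k < d"
  shows "A k j = cnj (A j k)"
proof -
  have "Im (A j j + cnj c * A k j + c * A j k + cnj c * c * A k k) = 0" for c
    using assms(1) unfolding hpos_def hform_two_units[OF assms(2,3), symmetric] by blast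
  \<comment> \<open>\<open>c = 1\<close> makes the imaginary parts of \<open>A k j\<close> and
    \<open>A j k\<close> opposite, \<open>c = \<i>\<close> makes their real parts equal.\<close>
  from this[of 1] this[of \<i>] show ?thesis
    using hpos_diag(1)[OF assms(1)] assms by (simp add: complex_eq_iff)
qed

text \<open>With \<open>A k k = 0\<close> the form at the j-th unit vector plus \<open>c\<close>
  times the k-th has no quadratic term in \<open>c\<close>, so a nonzero off-diagonal entry would
  drive it below zero.\<close>

lemma hpos_zero_diag:
  assumes "hpos d A" "j < d" "k < d" "A k k = 0"
  shows "A j k = 0"
proof (rule ccontr)
  assume nz: "A j k \<noteq> 0"
  \<comment> \<open>Tuned so that the form takes the value \<open>- Re (A j j) - 2\<close>.\<close>
  define s where "s = (Re (A j j) + 1) / (cmod (A j k))\<^sup>2"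
  define c where "c = - of_real s * cnj (A j k)"
  have "0 \<le> Re (A j j + cnj c * A k j + c * A j k + cnj c * c * A k k)"
    using assms(1) unfolding hpos_def hform_two_units[OF assms(2,3), symmetric] by blast
  also have "A j j + cnj c * A k j + c * A j k + cnj c * c * A k k = A j j - of_real (2 * s * (cmod (A j k))\<^sup>2)"
    using complex_norm_square[of "A j k"]
    by (simp add: assms(4) hpos_hermitian[OF assms(1-3)] c_def mult_ac)
  also have "Re \<dots> = - Re (A j j) - 2"
    using nz by (simp add: s_def)
  finally show False using hpos_diag(2)[OF assms(1,2)] by simp
qed

text \<open>Completing the square: the new form at \<open>v\<close> is the old one at
  \<open>v\<close> with coordinate \<open>k\<close> shifted by minus the k-th entry of A v divided
  by \<open>A k k\<close>. For \<open>A k k = 0\<close> both the correction and the shift vanish, as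
  division by zero yields zero.\<close>

lemma hpos_schur_complement:
  assumes A: "hpos d A" and k: "k < d"
  shows "hpos d (\<lambda>i j. A i j - A i k * A k j / A k k)"
proof -
  define a where "a = A k k"
  have cnj_a: "cnj a = a" using hpos_diag(1)[OF A k] by (simp add: a_def complex_eq_iff)
  have "hform d (\<lambda>i j. A i j - A i k * A k j / A k k) v =
    hform d A (\<lambda>i. v i + (if i = k then - (\<Sum>j<d. A k j * v j) / a else 0))" for v
  proof -
    define w where "w = (\<Sum>j<d. A k j * v j)"
    have w': "(\<Sum>i<d. cnj (v i) * A i k) = cnj w"
      unfolding w_def cnj_sum by (intro sum.cong refl) (simp add: hpos_hermitian[OF A _ k])
    have "hform d (\<lambda>i j. A i j - A i k * A k j / a) v
      = hform d A v - (\<Sum>i<d. cnj (v i) * A i k) * (\<Sum>j<d. A k j * v j) / a"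
      by (simp only: hform_def right_diff_distrib left_diff_distrib sum_subtractf sum_product sum_divide_distrib)
        (simp add: mult_ac)
    also have "\<dots> = hform d A v + cnj (- w / a) * w + (- w / a) * cnj w + cnj (- w / a) * (- w / a) * a"
      unfolding w' w_def[symmetric] by (cases "a = 0") (simp_all add: cnj_a mult.commute)
    also have "\<dots> = hform d A (\<lambda>i. v i + (if i = k then - w / a else 0))"
      unfolding hform_add_unit[OF k] w' w_def[symmetric] a_def[symmetric] ..
    finally show ?thesis unfolding w_def a_def .
  qed
  then show ?thesis using A unfolding hpos_def by simp
qed

text \<open>Elimination by Schur complements, one pivot at a time; rows already cleared stay zero. A
  zero pivot does no harm: its row is zero by \<open>hpos_zero_diag\<close> and Hermitian symmetry,
  and the vector added for it is zero too.\<close>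

lemma hpos_partial_cholesky:
  assumes "hpos d A" "m \<le> d"
  shows "\<exists>u B. hpos d B \<and> (\<forall>i<d. \<forall>j<d. A i j = (\<Sum>k<m. u k i * cnj (u k j)) + B i j)
    \<and> (\<forall>k<m. \<forall>j<d. B k j = 0)"
  using assms(2)
proof (induction m)
  case 0
  then show ?case using assms(1) by auto
next
  case (Suc m)
  then obtain u B where B: "hpos d B" "\<And>i j. i < d \<Longrightarrow> j < d \<Longrightarrow> A i j = (\<Sum>k<m. u k i * cnj (u k j)) + B i j"
    "\<And>k j. k < m \<Longrightarrow> j < d \<Longrightarrow> B k j = 0" by auto
  have m: "m < d" using Suc by simp
  define a where "a = Re (B m m)"
  have a: "B m m = of_real a" "0 \<le> a"
    using hpos_diag[OF B(1) m] by (simp_all add: a_def complex_eq_iff)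
  define u' where "u' = u(m := \<lambda>i. B i m / of_real (sqrt a))"
  define B' where "B' i j = B i j - B i m * B m j / B m m" for i j
  have "hpos d B'" unfolding B'_def by (rule hpos_schur_complement[OF B(1) m])
  moreover have "A i j = (\<Sum>k<Suc m. u' k i * cnj (u' k j)) + B' i j" if "i < d" "j < d" for i j
  proof -
    have "u' m i * cnj (u' m j) = B i m * B m j / B m m"
      using a(2) hpos_hermitian[OF B(1) that(2) m] by (simp add: u'_def a(1) of_real_mult[symmetric] del: of_real_mult)
    then show ?thesis using B(2)[OF that] by (simp add: B'_def u'_def)
  qed
  moreover have "B' k j = 0" if "k < Suc m" "j < d" for k j
  proof (cases "k < m")
    case True
    then show ?thesis using B(3)[of k] that(2) m by (simp add: B'_def)
  next
    case False
    then have "k = m" using that by simp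
    then show ?thesis
      using hpos_zero_diag[OF B(1) that(2) m] hpos_hermitian[OF B(1) that(2) m]
      by (cases "B m m = 0") (simp_all add: B'_def)
  qed
  ultimately show ?case by blast
qed

lemma hpos_cholesky:
  assumes "hpos d A"
  obtains u where "\<And>i j. i < d \<Longrightarrow> j < d \<Longrightarrow> A i j = (\<Sum>k<d. u k i * cnj (u k j))"
proof -
  obtain u B where B: "\<forall>i<d. \<forall>j<d. A i j = (\<Sum>k<d. u k i * cnj (u k j)) + B i j" "\<forall>k<d. \<forall>j<d. B k j = 0"
    using hpos_partial_cholesky[OF assms order_refl] by blast
  show thesis by (rule that[of u]) (use B in simp)
qed

section \<open>Quantum correlations as no-signalling boxes\<close>

lemma mtrace_mult_kron:
  assumes "\<sigma> \<in> carrier_mat (d * d) (d * d)" "M \<in> carrier_mat d d" "N \<in> carrier_mat d d"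
  shows "mtrace (\<sigma> * kron M N) =
    (\<Sum>i<d * d. \<Sum>j<d * d. \<sigma> $$ (i, j) * (M $$ (j div d, i div d) * N $$ (j mod d, i mod d)))"
  using assms by (simp add: mtrace_def kron_def scalar_prod_def lessThan_atLeast0)

lemma sum_swap_pairs:
  "(\<Sum>i\<in>A. \<Sum>j\<in>B. \<Sum>k\<in>C. \<Sum>l\<in>D. f i j k l) = (\<Sum>k\<in>C. \<Sum>l\<in>D. \<Sum>i\<in>A. \<Sum>j\<in>B. f i j k l)"
proof -
  have "(\<Sum>i\<in>A. \<Sum>j\<in>B. \<Sum>k\<in>C. \<Sum>l\<in>D. f i j k l) = (\<Sum>i\<in>A. \<Sum>k\<in>C. \<Sum>j\<in>B. \<Sum>l\<in>D. f i j k l)"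
    by (rule sum.cong[OF refl], rule sum.swap)
  also have "\<dots> = (\<Sum>k\<in>C. \<Sum>i\<in>A. \<Sum>l\<in>D. \<Sum>j\<in>B. f i j k l)"
    by (subst sum.swap, rule sum.cong[OF refl], rule sum.cong[OF refl], rule sum.swap)
  also have "\<dots> = (\<Sum>k\<in>C. \<Sum>l\<in>D. \<Sum>i\<in>A. \<Sum>j\<in>B. f i j k l)"
    by (rule sum.cong[OF refl], rule sum.swap)
  finally show ?thesis .
qed

text \<open>With \<open>M\<close> and \<open>N\<close> split into rank-one terms, the trace becomes
  a sum of values of the form of \<open>\<sigma>\<close> at the vectors \<open>v k l\<close>, the
  tensor products of the Cholesky vectors.\<close>

lemma mtrace_mult_kron_nonneg:
  assumes \<sigma>: "psd (d * d) \<sigma>" and M: "psd d M" and N: "psd d N"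
  shows "0 \<le> Re (mtrace (\<sigma> * kron M N))"
proof -
  obtain u where u: "\<And>i j. i < d \<Longrightarrow> j < d \<Longrightarrow> M $$ (i, j) = (\<Sum>k<d. u k i * cnj (u k j))"
    using hpos_cholesky[OF psd_imp_hpos[OF M]] by blast
  obtain w where w: "\<And>i j. i < d \<Longrightarrow> j < d \<Longrightarrow> N $$ (i, j) = (\<Sum>k<d. w k i * cnj (w k j))"
    using hpos_cholesky[OF psd_imp_hpos[OF N]] by blast
  define v where "v k l j = u k (j div d) * w l (j mod d)" for k l j
  have lt: "j div d < d" "j mod d < d" if "j < d * d" for j
    using that by (cases "d = 0"; simp add: less_mult_imp_div_less)+
  have "mtrace (\<sigma> * kron M N) =
    (\<Sum>i<d * d. \<Sum>j<d * d. \<sigma> $$ (i, j) * (M $$ (j div d, i div d) * N $$ (j mod d, i mod d)))"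
    by (rule mtrace_mult_kron) (use \<sigma> M N in \<open>auto simp: psd_def\<close>)
  also have "\<dots> = (\<Sum>i<d * d. \<Sum>j<d * d. \<Sum>k<d. \<Sum>l<d. cnj (v k l i) * \<sigma> $$ (i, j) * v k l j)"
  proof (intro sum.cong refl)
    fix i j assume "i \<in> {..<d * d}" "j \<in> {..<d * d}"
    then show "\<sigma> $$ (i, j) * (M $$ (j div d, i div d) * N $$ (j mod d, i mod d))
      = (\<Sum>k<d. \<Sum>l<d. cnj (v k l i) * \<sigma> $$ (i, j) * v k l j)"
      by (simp add: u w lt sum_product) (simp add: v_def sum_distrib_left mult_ac)
  qed
  also have "\<dots> = (\<Sum>k<d. \<Sum>l<d. hform (d * d) (\<lambda>i j. \<sigma> $$ (i, j)) (v k l))"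
    unfolding hform_def by (rule sum_swap_pairs)
  finally show ?thesis
    using psd_imp_hpos[OF \<sigma>] by (auto simp: hpos_def intro!: sum_nonneg)
qed

lemma quantum_box_no_signalling:
  fixes M N :: "'a::finite list \<Rightarrow> 'x::finite list \<Rightarrow> complex mat"
  assumes S: "(\<sigma>, M, N) \<in> quantum_strategies n d"
  shows "(\<lambda>y z a b. Re (mtrace (\<sigma> * kron (M a y) (N b z)))) \<in> ns_boxes n"
proof -
  have \<sigma>: "psd (d * d) \<sigma>" "mtrace \<sigma> = 1"
    using S by (auto simp: quantum_strategies_def density_def)
  then have \<sigma>c: "\<sigma> \<in> carrier_mat (d * d) (d * d)" by (simp add: psd_def)
  have M: "psd d (M a y)" "M a y \<in> carrier_mat d d" and N: "psd d (N a y)" "N a y \<in> carrier_mat d d"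
    if "a \<in> seqs n" "y \<in> seqs n" for a y
    using S that by (auto simp: quantum_strategies_def povm_def psd_def)
  have M1: "(\<Sum>y\<in>seqs n. M a y $$ (i, j)) = (if i = j then 1 else 0)"
    and N1: "(\<Sum>y\<in>seqs n. N a y $$ (i, j)) = (if i = j then 1 else 0)" if "a \<in> seqs n" "i < d" "j < d" for a i j
    using S that by (auto simp: quantum_strategies_def povm_def)
  have lt: "j div d < d" "j mod d < d" if "j < d * d" for j
    using that by (cases "d = 0"; simp add: less_mult_imp_div_less)+
  define T where "T y z a b = mtrace (\<sigma> * kron (M a y) (N b z))" for y z a b
  have T: "T y z a b = (\<Sum>i<d * d. \<Sum>j<d * d. \<sigma> $$ (i, j) * (M a y $$ (j div d, i div d) * N b z $$ (j mod d, i mod d)))"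
    if "y \<in> seqs n" "z \<in> seqs n" "a \<in> seqs n" "b \<in> seqs n" for y z a b
    unfolding T_def by (rule mtrace_mult_kron[OF \<sigma>c M(2) N(2)]) (use that in auto)
  \<comment> \<open>A POVM sums to the identity, so the input \<open>a\<close> of the first player
    drops out; \<open>sumN\<close> is the mirror image.\<close>
  have sumM: "(\<Sum>y\<in>seqs n. T y z a b) =
    (\<Sum>i<d * d. \<Sum>j<d * d. \<sigma> $$ (i, j) * ((if j div d = i div d then 1 else 0) * N b z $$ (j mod d, i mod d)))"
    if "z \<in> seqs n" "a \<in> seqs n" "b \<in> seqs n" for z a b
  proof -
    have "(\<Sum>y\<in>seqs n. T y z a b) = (\<Sum>i<d * d. \<Sum>j<d * d. \<Sum>y\<in>seqs n.
        \<sigma> $$ (i, j) * (M a y $$ (j div d, i div d) * N b z $$ (j mod d, i mod d)))"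
      using that by (simp add: T sum.swap[of _ "{..<d * d}" "seqs n"])
    then show ?thesis
      using that by (simp add: sum_distrib_left[symmetric] sum_distrib_right[symmetric] M1 lt)
  qed
  have sumN: "(\<Sum>z\<in>seqs n. T y z a b) =
    (\<Sum>i<d * d. \<Sum>j<d * d. \<sigma> $$ (i, j) * (M a y $$ (j div d, i div d) * (if j mod d = i mod d then 1 else 0)))"
    if "y \<in> seqs n" "a \<in> seqs n" "b \<in> seqs n" for y a b
  proof -
    have "(\<Sum>z\<in>seqs n. T y z a b) = (\<Sum>i<d * d. \<Sum>j<d * d. \<Sum>z\<in>seqs n.
        \<sigma> $$ (i, j) * (M a y $$ (j div d, i div d) * N b z $$ (j mod d, i mod d)))"
      using that by (simp add: T sum.swap[of _ "{..<d * d}" "seqs n"])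
    then show ?thesis
      using that by (simp add: sum_distrib_left[symmetric] N1 lt)
  qed
  have tot: "(\<Sum>y\<in>seqs n. \<Sum>z\<in>seqs n. T y z a b) = 1" if ab: "a \<in> seqs n" "b \<in> seqs n" for a b
  proof -
    have "(\<Sum>y\<in>seqs n. \<Sum>z\<in>seqs n. T y z a b) = (\<Sum>i<d * d. \<Sum>j<d * d. \<Sum>y\<in>seqs n.
        \<sigma> $$ (i, j) * (M a y $$ (j div d, i div d) * (if j mod d = i mod d then 1 else 0)))"
      using ab by (simp add: sumN sum.swap[of _ "{..<d * d}" "seqs n"])
    also have "\<dots> = (\<Sum>i<d * d. \<Sum>j<d * d. if j = i then \<sigma> $$ (i, j) else 0)"
    proof (intro sum.cong refl)
      fix i j assume ij: "i \<in> {..<d * d}" "j \<in> {..<d * d}"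
      \<comment> \<open>Quotient and remainder determine the index, so the two Kronecker deltas
        multiply to the delta of the product space, which leaves the trace of
        \<open>\<sigma>\<close>.\<close>
      have eq: "j = i \<longleftrightarrow> j div d = i div d \<and> j mod d = i mod d"
        by (metis div_mult_mod_eq)
      show "(\<Sum>y\<in>seqs n. \<sigma> $$ (i, j) * (M a y $$ (j div d, i div d) * (if j mod d = i mod d then 1 else 0)))
        = (if j = i then \<sigma> $$ (i, j) else 0)"
        unfolding eq using ij ab
        by (simp add: sum_distrib_left[symmetric] sum_distrib_right[symmetric] M1 lt del: mult_1_right mult_zero_right)
    qed
    also have "\<dots> = mtrace \<sigma>" using \<sigma>c by (simp add: mtrace_def)
    finally show ?thesis by (simp add: \<sigma>)
  qed
  have "(\<lambda>y z a b. Re (T y z a b)) \<in> ns_boxes n"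
    unfolding ns_boxes_def
  proof (intro CollectI conjI ballI)
    fix y z :: "'x list" and a b :: "'a list"
    assume "y \<in> seqs n" "z \<in> seqs n" "a \<in> seqs n" "b \<in> seqs n"
    then show "0 \<le> Re (T y z a b)"
      unfolding T_def by (intro mtrace_mult_kron_nonneg[of d] \<sigma> M N)
  next
    show "(\<Sum>y\<in>seqs n. \<Sum>z\<in>seqs n. Re (T y z a b)) = 1" if "a \<in> seqs n" "b \<in> seqs n" for a b
      using arg_cong[OF tot[OF that], of Re] by simp
  qed (simp_all add: Re_sum[symmetric] sumM sumN del: Re_sum)
  then show ?thesis by (simp add: T_def)
qed

lemma deterministic_quantum_strategy:
  fixes f g :: "'a::finite list \<Rightarrow> 'x::finite list"
  assumes f: "f \<in> seqs n \<rightarrow> seqs n" and g: "g \<in> seqs n \<rightarrow> seqs n"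
  shows "\<exists>\<sigma> M N. (\<sigma>, M, N) \<in> quantum_strategies n 1 \<and>
    (\<forall>us vs xs. Re (mtrace (\<sigma> * kron (M us xs) (N vs xs))) = (if f us = xs \<and> g vs = xs then 1 else 0))"
proof -
  \<comment> \<open>In dimension one a POVM is a probability vector, here the point mass at
    \<open>h us\<close>.\<close>
  define D :: "('a list \<Rightarrow> 'x list) \<Rightarrow> 'a list \<Rightarrow> 'x list \<Rightarrow> complex mat"
    where "D h us xs = (if h us = xs then 1\<^sub>m 1 else 0\<^sub>m 1 1)" for h us xs
  have D: "D h us xs \<in> carrier_mat 1 1" "D h us xs $$ (0, 0) = (if h us = xs then 1 else 0)" for h us xs
    by (simp_all add: D_def)
  have "psd 1 (1\<^sub>m 1)" "psd 1 (0\<^sub>m 1 1)"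
    by (auto simp: psd_def Let_def)
  then have "psd 1 (D h us xs)" for h us xs by (simp add: D_def)
  moreover have "(\<Sum>xs\<in>seqs n. D h us xs $$ (0, 0)) = 1" if "h \<in> seqs n \<rightarrow> seqs n" "us \<in> seqs n" for h us
    using that by (auto simp: D)
  ultimately have "\<forall>us\<in>seqs n. povm 1 (seqs n) (D h us)" if "h \<in> seqs n \<rightarrow> seqs n" for h
    using that by (auto simp: povm_def)
  moreover have "density (1 * 1) (1\<^sub>m 1)"
    using \<open>psd 1 (1\<^sub>m 1)\<close> by (simp add: density_def mtrace_def)
  ultimately have "(1\<^sub>m 1, D f, D g) \<in> quantum_strategies n 1"
    using f g by (simp add: quantum_strategies_def)
  moreover have "mtrace (1\<^sub>m 1 * kron (D f us xs) (D g vs xs)) = (if f us = xs \<and> g vs = xs then 1 else 0)" for us vs xs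
    by (subst mtrace_mult_kron[OF _ D(1) D(1)]) (auto simp: D)
  ultimately show ?thesis by (intro exI[of _ "1\<^sub>m 1"] exI[of _ "D f"] exI[of _ "D g"]) simp
qed

text \<open>The sets of attainable values are nested, but \<open>Sup\<close> on the reals is
  monotone only for nonempty sets that are bounded above. The bound \<open>B\<close> provides the
  latter, the classical maximum the former.\<close>

lemma omega_chain:
  fixes W :: "'x::finite \<Rightarrow> 'a::finite \<Rightarrow> real"
  assumes B: "\<And>Q :: 'x list \<Rightarrow> 'x list \<Rightarrow> 'a list \<Rightarrow> 'a list \<Rightarrow> real.
    Q \<in> ns_boxes n \<Longrightarrow> game_sum W n (\<lambda>xs us vs. Q xs xs us vs) \<le> B"
  shows "omega_c W n \<le> omega_q W n" "omega_q W n \<le> omega_ns W n" "omega_ns W n \<le> B"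
proof -
  let ?C = "(\<lambda>(f, g). game_sum W n (\<lambda>xs us vs. if f us = xs \<and> g vs = xs then 1 else 0))
      ` ((seqs n \<rightarrow>\<^sub>E (seqs n :: 'x list set)) \<times> (seqs n \<rightarrow>\<^sub>E (seqs n :: 'x list set)))"
  let ?Q = "{game_sum W n (\<lambda>xs us vs. Re (mtrace (\<sigma> * kron (M us xs) (N vs xs))))
      | d \<sigma> M N. d \<ge> 1 \<and> (\<sigma>, M, N) \<in> quantum_strategies n d}"
  let ?N = "{game_sum W n (\<lambda>xs us vs. Q xs xs us vs) | Q :: 'x list \<Rightarrow> 'x list \<Rightarrow> 'a list \<Rightarrow> 'a list \<Rightarrow> real. Q \<in> ns_boxes n}"
  have "finite ?C" by (intro finite_imageI finite_cartesian_product finite_PiE) auto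
  moreover have "?C \<noteq> {}" by (simp add: PiE_eq_empty_iff)
  ultimately have MaxC: "Max ?C \<in> ?C" by (rule Max_in)
  have CQ: "?C \<subseteq> ?Q"
  proof clarify
    fix f g :: "'a list \<Rightarrow> 'x list"
    assume "f \<in> seqs n \<rightarrow>\<^sub>E seqs n" "g \<in> seqs n \<rightarrow>\<^sub>E seqs n"
    then have fg: "f \<in> seqs n \<rightarrow> seqs n" "g \<in> seqs n \<rightarrow> seqs n" by auto
    obtain \<sigma> M N where "(\<sigma>, M, N) \<in> quantum_strategies n 1"
      "\<And>us vs xs. Re (mtrace (\<sigma> * kron (M us xs) (N vs xs))) = (if f us = xs \<and> g vs = xs then 1 else 0)"
      using deterministic_quantum_strategy[OF fg] by blast
    then show "\<exists>d \<sigma> M N. game_sum W n (\<lambda>xs us vs. if f us = xs \<and> g vs = xs then 1 else 0)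
        = game_sum W n (\<lambda>xs us vs. Re (mtrace (\<sigma> * kron (M us xs) (N vs xs))))
      \<and> d \<ge> 1 \<and> (\<sigma>, M, N) \<in> quantum_strategies n d"
      by (intro exI[of _ 1] exI[of _ \<sigma>] exI[of _ M] exI[of _ N]) simp
  qed
  have QN: "?Q \<subseteq> ?N"
  proof
    fix v assume v: "v \<in> ?Q"
    obtain d \<sigma> and M N :: "'a list \<Rightarrow> 'x list \<Rightarrow> complex mat"
      where *: "v = game_sum W n (\<lambda>xs us vs. Re (mtrace (\<sigma> * kron (M us xs) (N vs xs))))"
        "(\<sigma>, M, N) \<in> quantum_strategies n d"
      using v by (elim CollectE exE conjE)
    show "v \<in> ?N"
      by (intro CollectI exI[of _ "\<lambda>y z a b. Re (mtrace (\<sigma> * kron (M a y) (N b z)))"] conjI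
          *(1) quantum_box_no_signalling[OF *(2)])
  qed
  have NB: "v \<le> B" if v: "v \<in> ?N" for v
  proof -
    obtain Q :: "'x list \<Rightarrow> 'x list \<Rightarrow> 'a list \<Rightarrow> 'a list \<Rightarrow> real"
      where *: "v = game_sum W n (\<lambda>xs us vs. Q xs xs us vs)" "Q \<in> ns_boxes n"
      using v by (elim CollectE exE conjE)
    show ?thesis unfolding *(1) by (rule B[OF *(2)])
  qed
  have bN: "bdd_above ?N" by (rule bdd_aboveI[OF NB])
  show "omega_c W n \<le> omega_q W n"
    unfolding omega_c_def omega_q_def
    by (rule cSup_upper[OF subsetD[OF CQ MaxC] bdd_above_mono[OF bN QN]])
  have nonempty: "A \<noteq> {}" if "v \<in> A" for v :: real and A
    using that by auto
  have Qne: "?Q \<noteq> {}" by (rule nonempty, rule subsetD[OF CQ MaxC])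
  show "omega_q W n \<le> omega_ns W n"
    unfolding omega_q_def omega_ns_def by (rule cSup_subset_mono[OF Qne bN QN])
  show "omega_ns W n \<le> B"
    unfolding omega_ns_def
  proof (rule cSup_least)
    show "?N \<noteq> {}" by (rule nonempty, rule subsetD[OF QN subsetD[OF CQ MaxC]])
  qed (rule NB)
qed

section \<open>Achievability by a maximal code\<close>

text \<open>Feinstein's greedy construction: codewords are added as long as the part of their typical
  set that is not yet decoded has conditional probability more than \<open>1/2\<close>.\<close>

lemma greedy_code:
  fixes k :: "'b \<Rightarrow> 'c \<Rightarrow> real"
  assumes "finite S" "finite R" and k: "\<And>x a. 0 \<le> k x a"
  shows "\<exists>C f. C \<subseteq> S \<and> (\<forall>a x. f a = Some x \<longrightarrow> x \<in> C \<and> T x a) \<and>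
    (\<forall>x\<in>C. 1 / 2 \<le> (\<Sum>a | a \<in> R \<and> f a = Some x. k x a)) \<and>
    (\<forall>x\<in>S. (\<Sum>a | a \<in> R \<and> T x a \<and> f a = None. k x a) \<le> 1 / 2)"
  using assms(1)
proof (induction S)
  case empty
  then show ?case by (intro exI[of _ "{}"] exI[of _ "\<lambda>_. None"]) simp
next
  case (insert x S)
  then obtain C f where C: "C \<subseteq> S" and f: "\<And>a x. f a = Some x \<Longrightarrow> x \<in> C \<and> T x a"
    and code: "\<And>x. x \<in> C \<Longrightarrow> 1 / 2 \<le> (\<Sum>a | a \<in> R \<and> f a = Some x. k x a)"
    and rest: "\<And>x. x \<in> S \<Longrightarrow> (\<Sum>a | a \<in> R \<and> T x a \<and> f a = None. k x a) \<le> 1 / 2"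
    by blast
  show ?case
  proof (cases "(\<Sum>a | a \<in> R \<and> T x a \<and> f a = None. k x a) \<le> 1 / 2")
    case True
    then show ?thesis
      using C f code rest by (intro exI[of _ C] exI[of _ f]) auto
  next
    case False
    define g where "g a = (if T x a \<and> f a = None then Some x else f a)" for a
    have "x \<notin> C" using insert C by auto
    then have fx: "f a \<noteq> Some x" for a using f by blast
    have "{a. a \<in> R \<and> g a = Some x} = {a. a \<in> R \<and> T x a \<and> f a = None}"
      using fx by (auto simp: g_def)
    moreover have "{a. a \<in> R \<and> g a = Some y} = {a. a \<in> R \<and> f a = Some y}" if "y \<in> C" for y
      using that \<open>x \<notin> C\<close> by (auto simp: g_def)
    \<comment> \<open>A new codeword only shrinks the undecoded region, so the bounds for inputs
      treated before persist and one pass over \<open>S\<close> is enough.\<close>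
    moreover have "(\<Sum>a | a \<in> R \<and> T y a \<and> g a = None. k y a) \<le> 1 / 2" if "y \<in> S" for y
    proof -
      have "(\<Sum>a | a \<in> R \<and> T y a \<and> g a = None. k y a) \<le> (\<Sum>a | a \<in> R \<and> T y a \<and> f a = None. k y a)"
        using assms(2) by (intro sum_mono2) (auto simp: g_def k split: if_splits)
      then show ?thesis using rest[OF that] by linarith
    qed
    moreover have "(\<Sum>a | a \<in> R \<and> T x a \<and> g a = None. k x a) \<le> 1 / 2"
    proof -
      have none: "{a. a \<in> R \<and> T x a \<and> g a = None} = {}" by (auto simp: g_def)
      show ?thesis unfolding none by simp
    qed
    moreover have "\<forall>a y. g a = Some y \<longrightarrow> y \<in> insert x C \<and> T y a"
      using f by (auto simp: g_def)
    ultimately show ?thesis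
      using C code False by (intro exI[of _ "insert x C"] exI[of _ g]) auto
  qed
qed

text \<open>Maximality makes the code large. Typical pairs have mass at least 3/4, of which at most
  1/2 falls on undecoded outputs, so the decoded region \<open>D\<close> has output probability at
  least 1/4. By the assumption on \<open>T\<close>, the decoding set of one codeword has output
  probability at most \<open>c\<close>.\<close>

lemma one_shot_code:
  fixes k :: "'b \<Rightarrow> 'c \<Rightarrow> real" and p :: "'b \<Rightarrow> real"
  assumes fin: "finite S" "finite R" and k: "\<And>x a. 0 \<le> k x a" "\<And>x. (\<Sum>a\<in>R. k x a) \<le> 1"
    and p: "\<And>x. 0 \<le> p x" "(\<Sum>x\<in>S. p x) = 1"
    and T: "\<And>x a. T x a \<Longrightarrow> (\<Sum>y\<in>S. p y * k y a) \<le> c * k x a"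
    and c: "0 \<le> c"
    and mass: "3 / 4 \<le> (\<Sum>x\<in>S. \<Sum>a | a \<in> R \<and> T x a. p x * k x a)"
  obtains C f where "C \<subseteq> S" "\<And>a x. f a = Some x \<Longrightarrow> x \<in> C \<and> T x a"
    "\<And>x. x \<in> C \<Longrightarrow> 1 / 2 \<le> (\<Sum>a | a \<in> R \<and> f a = Some x. k x a)"
    "1 / 4 \<le> real (card C) * c"
proof -
  obtain C f where C: "C \<subseteq> S" and f: "\<And>a x. f a = Some x \<Longrightarrow> x \<in> C \<and> T x a"
    and code: "\<And>x. x \<in> C \<Longrightarrow> 1 / 2 \<le> (\<Sum>a | a \<in> R \<and> f a = Some x. k x a)"
    and rest: "\<And>x. x \<in> S \<Longrightarrow> (\<Sum>a | a \<in> R \<and> T x a \<and> f a = None. k x a) \<le> 1 / 2"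
    using greedy_code[OF fin, of k T] k by blast
  have finC: "finite C" using C fin finite_subset by blast
  define D where "D = {a. a \<in> R \<and> f a \<noteq> None}"
  have finD: "finite D" using fin by (simp add: D_def)
  have D: "D = (\<Union>x\<in>C. {a. a \<in> R \<and> f a = Some x})"
    using f by (auto simp: D_def)
  have split: "(\<Sum>a | a \<in> R \<and> T x a. p x * k x a) \<le> p x * (1 / 2) + (\<Sum>a\<in>D. p x * k x a)" if "x \<in> S" for x
  proof -
    have "(\<Sum>a | a \<in> R \<and> T x a. p x * k x a)
      \<le> (\<Sum>a\<in>{a. a \<in> R \<and> T x a \<and> f a = None} \<union> D. p x * k x a)"
      using fin finD by (intro sum_mono2) (auto simp: D_def k p)
    also have "\<dots> = p x * (\<Sum>a | a \<in> R \<and> T x a \<and> f a = None. k x a) + (\<Sum>a\<in>D. p x * k x a)"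
      using fin finD by (subst sum.union_disjoint) (auto simp: D_def sum_distrib_left)
    also have "\<dots> \<le> p x * (1 / 2) + (\<Sum>a\<in>D. p x * k x a)"
      by (intro add_right_mono mult_left_mono rest that p)
    finally show ?thesis .
  qed
  have "3 / 4 \<le> (\<Sum>x\<in>S. p x * (1 / 2) + (\<Sum>a\<in>D. p x * k x a))"
    using mass by (rule order_trans) (intro sum_mono split)
  also have "\<dots> = 1 / 2 + (\<Sum>a\<in>D. \<Sum>x\<in>S. p x * k x a)"
    by (simp add: sum.distrib sum_divide_distrib[symmetric] p sum.swap[of _ S D])
  also have "(\<Sum>a\<in>D. \<Sum>x\<in>S. p x * k x a) = (\<Sum>y\<in>C. \<Sum>a | a \<in> R \<and> f a = Some y. \<Sum>x\<in>S. p x * k x a)"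
    unfolding D using fin finC by (intro sum.UNION_disjoint) auto
  also have "\<dots> \<le> (\<Sum>y\<in>C. c)"
  proof (intro sum_mono)
    fix y assume "y \<in> C"
    have "(\<Sum>a | a \<in> R \<and> f a = Some y. \<Sum>x\<in>S. p x * k x a) \<le> (\<Sum>a | a \<in> R \<and> f a = Some y. c * k y a)"
      using f T by (intro sum_mono) auto
    also have "\<dots> \<le> (\<Sum>a\<in>R. c * k y a)"
      using fin c k by (intro sum_mono2) auto
    also have "\<dots> \<le> c"
      using mult_left_mono[OF k(2)[of y] c] by (simp add: sum_distrib_left)
    finally show "(\<Sum>a | a \<in> R \<and> f a = Some y. \<Sum>x\<in>S. p x * k x a) \<le> c" .
  qed
  finally have "1 / 4 \<le> real (card C) * c" by simp
  then show thesis using that C f code by blast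
qed

text \<open>Both players use the same decoder. Given the input their observations are independent,
  so they are both right with the square of the probability that one of them is.\<close>

lemma omega_c_ge:
  fixes W :: "'x::finite \<Rightarrow> 'a::finite \<Rightarrow> real"
  assumes F: "F \<in> seqs n \<rightarrow> seqs n"
  shows "(1 / real (card (UNIV :: 'x set))) ^ n *
    (\<Sum>xs\<in>seqs n. (\<Sum>us | us \<in> seqs n \<and> F us = xs. seqprod W n xs us)\<^sup>2) \<le> omega_c W n"
proof -
  let ?w = "\<lambda>xs us. if F us = xs then seqprod W n xs us else 0"
  let ?c = "(1 / real (card (UNIV :: 'x set))) ^ n"
  let ?G = "\<lambda>(f, g). game_sum W n (\<lambda>xs us vs. if f us = xs \<and> g vs = xs then 1 else 0)"
  have w: "(\<Sum>us | us \<in> seqs n \<and> F us = xs. seqprod W n xs us) = (\<Sum>us\<in>seqs n. ?w xs us)" for xs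
    using sum.inter_filter[of "seqs n" "seqprod W n xs" "\<lambda>us. F us = xs"] by simp
  have "?c * (\<Sum>xs\<in>seqs n. (\<Sum>us | us \<in> seqs n \<and> F us = xs. seqprod W n xs us)\<^sup>2)
    = (\<Sum>xs\<in>seqs n. \<Sum>us\<in>seqs n. \<Sum>vs\<in>seqs n. ?c * (?w xs us * ?w xs vs))"
    by (simp only: w power2_eq_square sum_product) (simp only: sum_distrib_left)
  \<comment> \<open>\<open>omega_c\<close> ranges over extensional functions, hence the restriction
    of \<open>F\<close>.\<close>
  also have "\<dots> = ?G (restrict F (seqs n), restrict F (seqs n))"
    unfolding game_sum_def Pn_eq_seqprod case_prod_conv by (intro sum.cong refl) auto
  also have "\<dots> \<le> omega_c W n"
    unfolding omega_c_def
  proof (rule Max_ge)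
    show "finite (?G ` ((seqs n \<rightarrow>\<^sub>E (seqs n :: 'x list set)) \<times> (seqs n \<rightarrow>\<^sub>E (seqs n :: 'x list set))))"
      by (intro finite_imageI finite_cartesian_product finite_PiE) auto
    show "?G (restrict F (seqs n), restrict F (seqs n))
      \<in> ?G ` ((seqs n \<rightarrow>\<^sub>E (seqs n :: 'x list set)) \<times> (seqs n \<rightarrow>\<^sub>E (seqs n :: 'x list set)))"
      using F by (intro imageI SigmaI restrict_PiE_iff[THEN iffD2]) auto
  qed
  finally show ?thesis .
qed

text \<open>The code is built for the test channel \<open>V\<close>, the game is played over
  \<open>W\<close>. On \<open>T\<close> the change of measure costs a factor \<open>b\<close>, so
  each player decodes a codeword with probability at least \<open>b / 2\<close>; the square of this
  meets at least \<open>1 / (4 * c)\<close> codewords.\<close>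

lemma omega_c_code_bound:
  fixes W V :: "'x::finite \<Rightarrow> 'a::finite \<Rightarrow> real" and p :: "'x \<Rightarrow> real"
  assumes W: "\<And>x a. 0 \<le> W x a"
    and V: "\<And>x a. 0 \<le> V x a" "\<And>x. (\<Sum>a\<in>UNIV. V x a) \<le> 1"
    and p: "distr p" and c: "0 < c" and b: "0 \<le> b"
    and T: "\<And>xs us. T xs us \<Longrightarrow> (\<Prod>i<n. \<Sum>x\<in>UNIV. p x * V x (us ! i)) \<le> c * seqprod V n xs us"
      "\<And>xs us. T xs us \<Longrightarrow> b * seqprod V n xs us \<le> seqprod W n xs us"
    and mass: "3 / 4 \<le> (\<Sum>xs\<in>seqs n. \<Sum>us | us \<in> seqs n \<and> T xs us. seqprod (\<lambda>x a. p x * V x a) n xs us)"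
  shows "(1 / real (card (UNIV :: 'x set))) ^ n * (b\<^sup>2 / (16 * c)) \<le> omega_c W n"
proof -
  define P where "P xs = (\<Prod>i<n. p (xs ! i))" for xs
  have PV: "seqprod (\<lambda>x a. p x * V x a) n xs us = P xs * seqprod V n xs us" for xs us
    by (simp add: seqprod_def P_def prod.distrib)
  have marg: "(\<Sum>xs\<in>seqs n. P xs * seqprod V n xs us) = (\<Prod>i<n. \<Sum>x\<in>UNIV. p x * V x (us ! i))" for us
    unfolding PV[symmetric] unfolding seqprod_def by (rule sum_seqs_prod)
  obtain C f where C: "C \<subseteq> seqs n" and f: "\<And>us xs. f us = Some xs \<Longrightarrow> xs \<in> C \<and> T xs us"
    and code: "\<And>xs. xs \<in> C \<Longrightarrow> 1 / 2 \<le> (\<Sum>us | us \<in> seqs n \<and> f us = Some xs. seqprod V n xs us)"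
    and card: "1 / 4 \<le> real (card C) * c"
  proof (rule one_shot_code[of "seqs n :: 'x list set" "seqs n :: 'a list set" "seqprod V n" P T c])
    show "(\<Sum>us\<in>seqs n. seqprod V n xs us) \<le> 1" for xs
      unfolding sum_seqprod by (intro prod_le_1 conjI sum_nonneg V)
    show "(\<Sum>xs\<in>seqs n. P xs) = 1"
      using p sum_seqs_prod[of "\<lambda>_. p" n] by (simp add: P_def distr_def)
    show "0 \<le> P xs" for xs using p by (simp add: P_def distr_def prod_nonneg)
    show "(\<Sum>xs\<in>seqs n. P xs * seqprod V n xs us) \<le> c * seqprod V n ys us" if "T ys us" for ys us
      unfolding marg by (rule T(1)[OF that])
    show "3 / 4 \<le> (\<Sum>xs\<in>seqs n. \<Sum>us | us \<in> seqs n \<and> T xs us. P xs * seqprod V n xs us)"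
      using mass unfolding PV .
  qed (use c in \<open>auto simp: seqprod_nonneg V\<close>)
  obtain y :: "'x list" where y: "y \<in> seqs n" using seqs_nonempty by blast
  define F where "F us = (case f us of None \<Rightarrow> y | Some xs \<Rightarrow> xs)" for us
  have F: "F \<in> seqs n \<rightarrow> seqs n"
    using f C y by (fastforce simp: F_def split: option.splits)
  have each: "(b / 2)\<^sup>2 \<le> (\<Sum>us | us \<in> seqs n \<and> F us = xs. seqprod W n xs us)\<^sup>2" if xs: "xs \<in> C" for xs
  proof (rule power_mono)
    have "b / 2 \<le> b * (\<Sum>us | us \<in> seqs n \<and> f us = Some xs. seqprod V n xs us)"
      using mult_left_mono[OF code[OF xs] b] by simp
    also have "\<dots> \<le> (\<Sum>us | us \<in> seqs n \<and> f us = Some xs. seqprod W n xs us)"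
      unfolding sum_distrib_left using f T(2) by (intro sum_mono) auto
    also have "\<dots> \<le> (\<Sum>us | us \<in> seqs n \<and> F us = xs. seqprod W n xs us)"
      by (intro sum_mono2) (auto simp: F_def seqprod_nonneg W)
    finally show "b / 2 \<le> \<dots>" .
  qed (use b in simp)
  have "b\<^sup>2 / (16 * c) = (1 / 4) / c * (b / 2)\<^sup>2" using c by (simp add: power2_eq_square field_simps)
  also have "\<dots> \<le> real (card C) * (b / 2)\<^sup>2"
    using card c by (intro mult_right_mono) (auto simp: field_simps)
  also have "\<dots> = (\<Sum>xs\<in>C. (b / 2)\<^sup>2)" by simp
  also have "\<dots> \<le> (\<Sum>xs\<in>C. (\<Sum>us | us \<in> seqs n \<and> F us = xs. seqprod W n xs us)\<^sup>2)"
    by (intro sum_mono each)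
  also have "\<dots> \<le> (\<Sum>xs\<in>seqs n. (\<Sum>us | us \<in> seqs n \<and> F us = xs. seqprod W n xs us)\<^sup>2)"
    using C by (intro sum_mono2) auto
  finally show ?thesis
    using omega_c_ge[OF F, of W] by (meson mult_left_mono order_trans zero_le_divide_1_iff zero_le_power of_nat_0_le_iff)
qed

text \<open>Chebyshev for both sums at once: off the typical set either
  \<open>seqprod Q n xs us\<close> is zero or one squared sum is at least \<open>r\<close>, so the
  excluded mass is at most the total variance over \<open>r\<close>, and \<open>large\<close> makes
  that at most 1/4. The positivity clause later allows products of letter probabilities to be
  written as exponentials of sums of logarithms.\<close>

lemma typical_mass:
  fixes Q :: "'x::finite \<Rightarrow> 'a::finite \<Rightarrow> real" and g h :: "'x \<Rightarrow> 'a \<Rightarrow> real"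
  assumes Q: "\<And>x a. 0 \<le> Q x a" and Q1: "(\<Sum>x\<in>UNIV. \<Sum>a\<in>UNIV. Q x a) = 1"
    and g: "(\<Sum>x\<in>UNIV. \<Sum>a\<in>UNIV. Q x a * g x a) = 0" and h: "(\<Sum>x\<in>UNIV. \<Sum>a\<in>UNIV. Q x a * h x a) = 0"
    and d: "0 < d" and n: "0 < n"
    and large: "4 * (\<Sum>x\<in>UNIV. \<Sum>a\<in>UNIV. Q x a * ((g x a)\<^sup>2 + (h x a)\<^sup>2)) \<le> real n * d\<^sup>2"
  shows "3 / 4 \<le> (\<Sum>xs\<in>seqs n. \<Sum>us | us \<in> seqs n \<and> (\<forall>i<n. 0 < Q (xs ! i) (us ! i)) \<and>
      \<bar>\<Sum>i<n. g (xs ! i) (us ! i)\<bar> \<le> n * d \<and> \<bar>\<Sum>i<n. h (xs ! i) (us ! i)\<bar> \<le> n * d. seqprod Q n xs us)"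
proof -
  define S where "S f xs us = (\<Sum>i<n. f (xs ! i) (us ! i))" for f :: "'x \<Rightarrow> 'a \<Rightarrow> real" and xs us
  define T where "T xs us \<longleftrightarrow> (\<forall>i<n. 0 < Q (xs ! i) (us ! i)) \<and> \<bar>S g xs us\<bar> \<le> n * d \<and> \<bar>S h xs us\<bar> \<le> n * d" for xs us
  let ?V = "\<Sum>x\<in>UNIV. \<Sum>a\<in>UNIV. Q x a * ((g x a)\<^sup>2 + (h x a)\<^sup>2)"
  define r where "r = (real n * d)\<^sup>2"
  have r: "0 < r" using n d by (simp add: r_def)
  have "seqprod Q n xs us \<le> (if T xs us then seqprod Q n xs us else 0)
    + seqprod Q n xs us * ((S g xs us)\<^sup>2 + (S h xs us)\<^sup>2) / r" for xs us
  proof (cases "T xs us")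
    case True
    then show ?thesis using r by (simp add: seqprod_nonneg Q)
  next
    case F: False
    show ?thesis
    proof (cases "\<forall>i<n. 0 < Q (xs ! i) (us ! i)")
      case False
      then obtain i where "i < n" "Q (xs ! i) (us ! i) = 0"
        using Q by (metis less_eq_real_def)
      then have "seqprod Q n xs us = 0" by (auto simp: seqprod_def)
      then show ?thesis by simp
    next
      case True
      with F have "real n * d \<le> \<bar>S g xs us\<bar> \<or> real n * d \<le> \<bar>S h xs us\<bar>" by (auto simp: T_def)
      then have "r \<le> (S g xs us)\<^sup>2 \<or> r \<le> (S h xs us)\<^sup>2"
        using n d by (auto simp: r_def abs_le_square_iff[symmetric])
      then have "r \<le> (S g xs us)\<^sup>2 + (S h xs us)\<^sup>2"
        by (smt (verit) zero_le_power2)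
      then have "1 \<le> ((S g xs us)\<^sup>2 + (S h xs us)\<^sup>2) / r" using r by simp
      then have "seqprod Q n xs us * 1 \<le> seqprod Q n xs us * (((S g xs us)\<^sup>2 + (S h xs us)\<^sup>2) / r)"
        by (intro mult_left_mono seqprod_nonneg Q)
      then show ?thesis using F by simp
    qed
  qed
  then have "(\<Sum>xs\<in>seqs n. \<Sum>us\<in>seqs n. seqprod Q n xs us) \<le>
    (\<Sum>xs\<in>seqs n. \<Sum>us\<in>seqs n. (if T xs us then seqprod Q n xs us else 0)
      + seqprod Q n xs us * ((S g xs us)\<^sup>2 + (S h xs us)\<^sup>2) / r)"
    by (intro sum_mono)
  also have "\<dots> = (\<Sum>xs\<in>seqs n. \<Sum>us\<in>seqs n. if T xs us then seqprod Q n xs us else 0)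
    + ((\<Sum>xs\<in>seqs n. \<Sum>us\<in>seqs n. seqprod Q n xs us * (S g xs us)\<^sup>2)
     + (\<Sum>xs\<in>seqs n. \<Sum>us\<in>seqs n. seqprod Q n xs us * (S h xs us)\<^sup>2)) / r"
    by (simp add: sum.distrib sum_divide_distrib[symmetric] distrib_left)
  also have "\<dots> = (\<Sum>xs\<in>seqs n. \<Sum>us\<in>seqs n. if T xs us then seqprod Q n xs us else 0) + real n * ?V / r"
    unfolding S_def seqprod_variance[OF Q1 g] seqprod_variance[OF Q1 h]
    by (simp add: distrib_left sum.distrib)
  also have "real n * ?V / r \<le> 1 / 4"
  proof -
    have "4 * (real n * ?V) \<le> r"
      using mult_left_mono[OF large, of "real n"] by (simp add: r_def power2_eq_square mult_ac)
    then show ?thesis using r by (simp add: field_simps)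
  qed
  finally have "3 / 4 \<le> (\<Sum>xs\<in>seqs n. \<Sum>us\<in>seqs n. if T xs us then seqprod Q n xs us else 0)"
    using sum_seqprod_pair[OF Q1 g, of n] by simp
  also have "\<dots> = (\<Sum>xs\<in>seqs n. \<Sum>us | us \<in> seqs n \<and> T xs us. seqprod Q n xs us)"
    by (intro sum.cong refl sum.inter_filter[symmetric]) simp
  finally show ?thesis by (simp add: T_def S_def)
qed

lemma omega_c_lower_bound:
  fixes W :: "'x::finite \<Rightarrow> 'a::finite \<Rightarrow> real"
  assumes W: "\<And>x a. 0 \<le> W x a" and Q: "distr Q" "abs_cont Q W" and d: "0 < d"
  shows "eventually (\<lambda>n. (2 powr (objective Q W - d) / real (card (UNIV :: 'x set))) ^ n / 16 \<le> omega_c W n) sequentially"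
proof -
  \<comment> \<open>One \<open>e\<close> is lost in \<open>c\<close> and two in
    \<open>b\<^sup>2\<close>; together \<open>3 * e = d * ln 2\<close>.\<close>
  define e where "e = d * ln 2 / 3"
  have e: "0 < e" using d by (simp add: e_def)
  define p where "p = marg_X Q"
  define t where "t = marg_A Q"
  \<comment> \<open>At an input of mass zero the division makes \<open>V x\<close> the zero row, so
    \<open>V1\<close> is only an inequality.\<close>
  define V where "V x a = Q (x, a) / p x" for x a
  define q where "q x a = Q (x, a)" for x a
  have Q0: "0 \<le> Q u" for u using Q(1) unfolding distr_def by blast
  have V0: "0 \<le> V x a" for x a
    using Q0 marg_nonneg(1)[OF Q(1)] by (simp add: V_def p_def)
  have pV: "p x * V x a = q x a" for x a
    using distr_le_marg[OF Q(1), of x a] by (cases "p x = 0") (auto simp: V_def p_def q_def)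
  have V1: "(\<Sum>a\<in>UNIV. V x a) \<le> 1" for x
    by (simp add: V_def sum_divide_distrib[symmetric] p_def) (simp add: marg_X_def)
  have p: "distr p" using marg_nonneg(1)[OF Q(1)] sum_marg(1)[OF Q(1)] by (simp add: distr_def p_def)
  have q1: "(\<Sum>x\<in>UNIV. \<Sum>a\<in>UNIV. q x a) = 1"
    using Q(1) by (simp add: distr_def sum_UNIV_prod q_def)
  have t: "(\<Sum>x\<in>UNIV. p x * V x a) = t a" for a
    by (simp add: pV t_def marg_A_def q_def)
  \<comment> \<open>\<open>i\<close> is the information density and \<open>w\<close> the
    log-likelihood ratio of \<open>W\<close> against \<open>V\<close>. Their means under
    \<open>q\<close> are I(X;A) and minus the conditional divergence, in nats.\<close>
  define i where "i x a = ln (V x a) - ln (t a)" for x a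
  define w where "w x a = ln (W x a) - ln (V x a)" for x a
  define I where "I = (\<Sum>x\<in>UNIV. \<Sum>a\<in>UNIV. q x a * i x a)"
  define E where "E = (\<Sum>x\<in>UNIV. \<Sum>a\<in>UNIV. q x a * w x a)"
  have obj: "objective Q W * ln 2 = I + 2 * E"
  proof -
    have "(\<Sum>a\<in>UNIV. t a * ln (t a)) = (\<Sum>x\<in>UNIV. \<Sum>a\<in>UNIV. q x a * ln (t a))"
      by (simp add: t_def marg_A_def q_def sum_distrib_right) (rule sum.swap)
    then show ?thesis
      unfolding objective_ln(1)[OF Q W] p_def[symmetric] t_def[symmetric] I_def E_def i_def w_def
      by (simp add: V_def q_def[symmetric] right_diff_distrib sum_subtractf)
  qed
  define g where "g x a = i x a - I" for x a
  define h where "h x a = w x a - E" for x a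
  have g0: "(\<Sum>x\<in>UNIV. \<Sum>a\<in>UNIV. q x a * g x a) = 0" and h0: "(\<Sum>x\<in>UNIV. \<Sum>a\<in>UNIV. q x a * h x a) = 0"
    by (simp_all add: g_def h_def right_diff_distrib sum_subtractf sum_distrib_right[symmetric] q1
        I_def[symmetric] E_def[symmetric])
  define Z where "Z = 4 * (\<Sum>x\<in>UNIV. \<Sum>a\<in>UNIV. q x a * ((g x a)\<^sup>2 + (h x a)\<^sup>2))"
  have bound: "(2 powr (objective Q W - d) / real (card (UNIV :: 'x set))) ^ n / 16 \<le> omega_c W n"
    if n: "0 < n" and large: "Z \<le> real n * e\<^sup>2" for n
  proof -
    define T where "T xs us \<longleftrightarrow> (\<forall>j<n. 0 < q (xs ! j) (us ! j)) \<and>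
      \<bar>\<Sum>j<n. g (xs ! j) (us ! j)\<bar> \<le> n * e \<and> \<bar>\<Sum>j<n. h (xs ! j) (us ! j)\<bar> \<le> n * e" for xs us
    \<comment> \<open>The worst cases on \<open>T\<close>: there the sum of \<open>w\<close> is at
      least \<open>n * (E - e)\<close> and that of \<open>i\<close> at least
      \<open>n * (I - e)\<close>.\<close>
    define b where "b = exp (n * (E - e))"
    define c where "c = exp (- (n * (I - e)))"
    have pos: "0 < V x a" "0 < t a" "0 < W x a" if "0 < q x a" for x a
    proof -
      show "0 < V x a" using that pV[of x a] V0[of x a] by (metis less_eq_real_def mult_zero_right)
      show "0 < t a" using that distr_le_marg(3)[OF Q(1), of x a] by (simp add: q_def t_def)
      show "0 < W x a" using that Q(2) W[of x a] by (auto simp: abs_cont_def q_def less_le)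
    qed
    have "(1 / real (card (UNIV :: 'x set))) ^ n * (b\<^sup>2 / (16 * c)) \<le> omega_c W n"
    proof (rule omega_c_code_bound[OF W V0 V1 p])
      fix xs us assume T: "T xs us"
      then have q: "0 < q (xs ! j) (us ! j)" if "j < n" for j using that by (simp add: T_def)
      have eV: "seqprod V n xs us = exp (\<Sum>j<n. ln (V (xs ! j) (us ! j)))"
        by (rule seqprod_exp_sum) (use pos(1) q in auto)
      have eW: "seqprod W n xs us = exp (\<Sum>j<n. ln (W (xs ! j) (us ! j)))"
        by (rule seqprod_exp_sum) (use pos(3) q in auto)
      have eT: "(\<Prod>j<n. t (us ! j)) = exp (\<Sum>j<n. ln (t (us ! j)))"
        using pos(2) q by (force simp: exp_sum intro!: prod.cong)
      have "\<bar>(\<Sum>j<n. ln (V (xs ! j) (us ! j))) - (\<Sum>j<n. ln (t (us ! j))) - n * I\<bar> \<le> n * e"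
        "\<bar>(\<Sum>j<n. ln (W (xs ! j) (us ! j))) - (\<Sum>j<n. ln (V (xs ! j) (us ! j))) - n * E\<bar> \<le> n * e"
        using T by (simp_all add: T_def g_def h_def i_def w_def sum_subtractf)
      then show "(\<Prod>i<n. \<Sum>x\<in>UNIV. p x * V x (us ! i)) \<le> c * seqprod V n xs us"
        "b * seqprod V n xs us \<le> seqprod W n xs us"
        unfolding t eV eW eT b_def c_def exp_add[symmetric] exp_le_cancel_iff
        by (simp_all add: right_diff_distrib abs_le_iff)
    next
      show "3 / 4 \<le> (\<Sum>xs\<in>seqs n. \<Sum>us | us \<in> seqs n \<and> T xs us. seqprod (\<lambda>x a. p x * V x a) n xs us)"
        unfolding pV T_def
        by (rule typical_mass[OF _ q1 g0 h0 e n large[unfolded Z_def]]) (simp add: q_def Q0)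
    qed (simp_all add: b_def c_def)
    moreover have "b\<^sup>2 / (16 * c) = (2 powr (objective Q W - d)) ^ n / 16"
    proof -
      have "b\<^sup>2 / c = exp (n * (objective Q W * ln 2 - d * ln 2))"
        unfolding b_def c_def obj e_def
        by (simp add: exp_double[symmetric] exp_diff[symmetric] exp_minus field_simps exp_add[symmetric])
      also have "\<dots> = (2 powr (objective Q W - d)) ^ n"
        by (simp add: powr_def exp_of_nat_mult[symmetric] algebra_simps)
      finally show ?thesis by simp
    qed
    ultimately show ?thesis by (simp add: power_divide)
  qed
  have "eventually (\<lambda>n. Z / e\<^sup>2 \<le> real n) sequentially"
    using filterlim_real_sequentially by (simp add: filterlim_at_top)
  with eventually_gt_at_top[of 0] show ?thesis
  proof eventually_elim
    case (elim n)
    then show ?case using e by (intro bound) (simp_all add: field_simps)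
  qed
qed

section \<open>The asymptotic value\<close>

text \<open>The constant 16 shifts the normalized logarithm by \<open>4 / n\<close>, and the rate
  loss \<open>d\<close> is taken as \<open>e / 2\<close>, so the total error is eventually below
  \<open>e\<close>. The lower bound also makes \<open>z n\<close> positive, so that its logarithm is
  meaningful.\<close>

lemma log_div_tendsto_sandwich:
  fixes z :: "nat \<Rightarrow> real" and K N :: real
  assumes N: "0 < N" and lower: "\<And>d. 0 < d \<Longrightarrow> eventually (\<lambda>n. (2 powr (L - d) / N) ^ n / 16 \<le> z n) sequentially"
    and upper: "\<And>n. z n \<le> (2 powr L / N) ^ n"
  shows "(\<lambda>n. log 2 (z n) / real n) \<longlonglongrightarrow> L - log 2 N"
proof (rule tendstoI)
  fix e :: real assume e: "0 < e"
  have small: "eventually (\<lambda>n. 4 / real n < e / 2) sequentially"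
    using e by (intro order_tendstoD(2)[where y = 0]) (real_asymp, simp)
  have half: "0 < e / 2" using e by simp
  have log_pow: "log 2 ((2 powr M / N) ^ n) = real n * (M - log 2 N)" for M n
    using N by (simp add: log_nat_power log_divide)
  show "eventually (\<lambda>n. dist (log 2 (z n) / real n) (L - log 2 N) < e) sequentially"
    using small lower[OF half] eventually_gt_at_top[of 0]
  proof eventually_elim
    case (elim n)
    have pos: "0 < (2 powr (L - e / 2) / N) ^ n" using N by simp
    then have z: "0 < z n" using elim(2) by (smt (verit) divide_pos_pos)
    have "log 2 (z n) \<le> log 2 ((2 powr L / N) ^ n)"
      using z upper[of n] by (intro log_mono) auto
    then have up: "log 2 (z n) / n \<le> L - log 2 N"
      unfolding log_pow using elim(3) by (simp add: pos_divide_le_eq mult.commute)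
    have "log 2 ((2 powr (L - e / 2) / N) ^ n / 16) \<le> log 2 (z n)"
      using pos elim(2) by (intro log_mono) auto
    moreover have "log 2 (16 :: real) = 4"
      using log_nat_power[of 2 2 4] by simp
    then have "log 2 ((2 powr (L - e / 2) / N) ^ n / 16) = real n * (L - e / 2 - log 2 N) - 4"
      using pos N by (simp add: log_divide log_pow[symmetric])
    ultimately have "real n * (L - e / 2 - log 2 N) - 4 \<le> log 2 (z n)" by simp
    then have "(real n * (L - e / 2 - log 2 N) - 4) / n \<le> log 2 (z n) / n"
      by (intro divide_right_mono) auto
    moreover have "(real n * (L - e / 2 - log 2 N) - 4) / n = L - e / 2 - log 2 N - 4 / n"
      using elim(3) by (simp add: diff_divide_distrib)
    ultimately have "L - e / 2 - log 2 N - 4 / n \<le> log 2 (z n) / n" by simp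
    then show ?case using up elim(1) unfolding dist_real_def by linarith
  qed
qed

theorem mainTheorem2:
  fixes W :: "'x::finite \<Rightarrow> 'a::finite \<Rightarrow> real"
  assumes "channel W"
  shows "\<exists>Q :: 'x \<times> 'a \<Rightarrow> real. distr Q \<and> abs_cont Q W \<and>
           (\<forall>Q'. distr Q' \<and> abs_cont Q' W \<longrightarrow> objective Q' W \<le> objective Q W) \<and>
           (\<lambda>n. log 2 (omega_c W n) / real n) \<longlonglongrightarrow> objective Q W - log 2 (real (card (UNIV :: 'x set))) \<and>
           (\<lambda>n. log 2 (omega_q W n) / real n) \<longlonglongrightarrow> objective Q W - log 2 (real (card (UNIV :: 'x set))) \<and>
           (\<lambda>n. log 2 (omega_ns W n) / real n) \<longlonglongrightarrow> objective Q W - log 2 (real (card (UNIV :: 'x set)))"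
proof -
  have W: "\<And>x a. 0 \<le> W x a" using assms by (auto simp: channel_def)
  obtain Q where Q: "distr Q" "abs_cont Q W"
    and max: "\<And>Q'. distr Q' \<Longrightarrow> abs_cont Q' W \<Longrightarrow> objective Q' W \<le> objective Q W"
    using objective_attains_max[OF assms] by blast
  let ?N = "real (card (UNIV :: 'x set))"
  have mA: "distr (marg_A Q)"
    using marg_nonneg(2)[OF Q(1)] sum_marg(2)[OF Q(1)] by (simp add: distr_def)
  have supp: "W x a = 0" if "marg_A Q a = 0" for x a
    by (rule maximizer_marg_A_support[OF W Q max that])
  have renyi: "(\<Sum>a\<in>UNIV. (W x a)\<^sup>2 / marg_A Q a) \<le> 2 powr objective Q W" for x
    by (rule maximizer_renyi_bound[OF assms Q max])
  have ns: "game_sum W n (\<lambda>xs us vs. P xs xs us vs) \<le> (2 powr objective Q W / ?N) ^ n"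
    if "P \<in> ns_boxes n" for n and P :: "'x list \<Rightarrow> 'x list \<Rightarrow> 'a list \<Rightarrow> 'a list \<Rightarrow> real"
    by (rule ns_value_le[OF W mA supp renyi that])
  have chain: "omega_c W n \<le> omega_q W n" "omega_q W n \<le> omega_ns W n"
    "omega_ns W n \<le> (2 powr objective Q W / ?N) ^ n" for n
    by (rule omega_chain[of n W "(2 powr objective Q W / ?N) ^ n"], erule ns)+
  note lower = omega_c_lower_bound[OF W Q]
  have N: "0 < ?N" by (simp add: card_gt_0_iff)
  have "(\<lambda>n. log 2 (omega_c W n) / real n) \<longlonglongrightarrow> objective Q W - log 2 ?N"
    by (rule log_div_tendsto_sandwich[OF N lower]) (blast intro: chain order_trans)+
  moreover have "(\<lambda>n. log 2 (omega_q W n) / real n) \<longlonglongrightarrow> objective Q W - log 2 ?N"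
    by (rule log_div_tendsto_sandwich[OF N eventually_mono[OF lower]]) (blast intro: chain order_trans)+
  moreover have "(\<lambda>n. log 2 (omega_ns W n) / real n) \<longlonglongrightarrow> objective Q W - log 2 ?N"
    by (rule log_div_tendsto_sandwich[OF N eventually_mono[OF lower]]) (blast intro: chain order_trans)+
  ultimately show ?thesis using Q max by blast
qed

end
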